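(* Let $\lambda$ be a Salem number. Then for each integer $n\ge 2$, there exist an arithmetic lattice $\Gamma\subseteq\mathrm{Isom}(H^n)$ of the simplest type defined over $\mathbb{Q}(\lambda+\lambda^{-1})$ and a hyperbolic element $\gamma$ of $\Gamma$ such that $\lambda=e^{\ell(\gamma)}$.
   Context: A Salem number is a real algebraic integer $\lambda>1$ that is conjugate (over $\mathbb{Q}$) to $\lambda^{-1}$ and whose remaining conjugates lie on the unit circle; degree $2$ is allowed. (The field $\mathbb{Q}(\lambda+\lambda^{-1})$ is then totally real.) Let $f_n(x)=x_1^2+\cdots+x_n^2-x_{n+1}^2$ and $H^n=\{x\in\mathbb{R}^{n+1}: f_n(x)=-1,\ x_{n+1}>0\}$ (hyperboloid model of hyperbolic $n$-space). $\mathrm{O}^+(n,1)$ is the group of real matrices preserving $f_n$ and leaving $H^n$ invariant; it is identified with $\mathrm{Isom}(H^n)$. An element $\gamma\in\mathrm{Isom}(H^n)$ is hyperbolic if there is a unique geodesic in $H^n$ (its axis) along which $\gamma$ acts as a translation by a positive distance $\ell(\gamma)$, called the translation length of $\gamma$. Totally real number fields $K$ are taken as subfields of $\mathbb{R}$, with ring of integers $\mathfrak{o}_K$. A quadratic form $f(x)=x^tAx$ over $K$ in $n+1$ variables (with $A$ a symmetric matrix over $K$) is admissible if $f$ has signature $(n,1)$ and, for each nonidentity embedding $\sigma:K\to\mathbb{R}$, the form $f^\sigma$ obtained by applying $\sigma$ to the entries of $A$ is positive definite. For a subring $R\subseteq\mathbb{R}$, $\mathrm{O}'(f,R)$ is the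 group of $T\in\mathrm{GL}(n+1,R)$ with $T^tAT=A$ that leave invariant both components of the cone $\{x\in\mathbb{R}^{n+1}:f(x)<0\}$. A subgroup $\Gamma\subseteq\mathrm{O}^+(n,1)=\mathrm{Isom}(H^n)$ is an arithmetic lattice of the simplest type defined over $K$ if there exist an admissible quadratic form $f$ over $K$ in $n+1$ variables and $M\in\mathrm{GL}(n+1,\mathbb{R})$ such that $f(Mx)=f_n(x)$ for all $x\in\mathbb{R}^{n+1}$ and $M\Gamma M^{-1}$ is commensurable with $\mathrm{O}'(f,\mathfrak{o}_K)$ (their intersection has finite index in both). *)

theory Defs
  imports
    "HOL-Analysis.Analysis"
    "HOL-Algebra.Algebraic_Closure_Type"
    "HOL-Algebra.Generated_Fields"
    "HOL-Algebra.Embedded_Algebras"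
    "HOL-Algebra.Coset"
begin

definition rat_conjugates :: "real \<Rightarrow> complex set" where
  "rat_conjugates x =
     {z. \<exists>p :: rat poly. Factorial_Ring.irreducible p \<and> poly (map_poly of_rat p) x = 0 \<and>
                        poly (map_poly of_rat p) z = 0}"

definition salem_number :: "real \<Rightarrow> bool" where
  "salem_number x \<longleftrightarrow>
     1 < x \<and> algebraic_int x \<and>
     complex_of_real (inverse x) \<in> rat_conjugates x \<and>
     (\<forall>z \<in> rat_conjugates x - {complex_of_real x, complex_of_real (inverse x)}. cmod z = 1)"

abbreviation real_ring :: "real ring" where
  "real_ring \<equiv> ring_of_type_algebra"

definition rat_adjoin :: "real \<Rightarrow> real set" where
  "rat_adjoin x = generate_field real_ring {x}"

definition field_embeddings :: "real set \<Rightarrow> (real \<Rightarrow> 'a::field) set" where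
  "field_embeddings K = ring_hom (real_ring\<lparr>carrier := K\<rparr>) ring_of_type_algebra"

definition totally_real_number_field :: "real set \<Rightarrow> bool" where
  "totally_real_number_field K \<longleftrightarrow>
     subfield K real_ring \<and> ring.finite_dimension real_ring \<rat> K \<and>
     (\<forall>\<sigma> :: real \<Rightarrow> complex. \<sigma> \<in> field_embeddings K \<longrightarrow> \<sigma> ` K \<subseteq> \<real>)"

definition ring_of_integers :: "real set \<Rightarrow> real set" where
  "ring_of_integers K = {x \<in> K. algebraic_int x}"

definition entries_in :: "real^'m^'m \<Rightarrow> real set \<Rightarrow> bool" where
  "entries_in A R \<longleftrightarrow> (\<forall>i j. A $ i $ j \<in> R)"

definition quad_form :: "real^'m^'m \<Rightarrow> real^'m::finite \<Rightarrow> real" where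
  "quad_form A x = x \<bullet> (A *v x)"

definition positive_definite_form :: "real^'m^'m::finite \<Rightarrow> bool" where
  "positive_definite_form A \<longleftrightarrow> (\<forall>x. x \<noteq> 0 \<longrightarrow> 0 < quad_form A x)"

text \<open>Signature in the sense of Sylvester: the numbers of positive and of negative
  coefficients in a real diagonalisation of the form.\<close>

definition has_signature :: "real^'m^'m::finite \<Rightarrow> nat \<Rightarrow> nat \<Rightarrow> bool" where
  "has_signature A p q \<longleftrightarrow>
     (\<exists>(S :: real^'m^'m) (d :: 'm \<Rightarrow> real). invertible S \<and>
        transpose S ** A ** S = (\<chi> i j. if i = j then d i else 0) \<and>
        card {i. 0 < d i} = p \<and> card {i. d i < 0} = q)"

text \<open>Real \<open>(n+1)\<close>-space is rendered as \<open>real^('n option)\<close> with \<open>n = CARD('n)\<close>: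
  the coordinates \<open>Some i\<close> are the first \<open>n\<close> ones and \<open>None\<close> is the last one.\<close>

definition admissible_form :: "real set \<Rightarrow> real^('n::finite option)^('n option) \<Rightarrow> bool" where
  "admissible_form K A \<longleftrightarrow>
     entries_in A K \<and> transpose A = A \<and> has_signature A CARD('n) 1 \<and>
     (\<forall>\<sigma> \<in> field_embeddings K. (\<exists>x \<in> K. \<sigma> x \<noteq> x) \<longrightarrow>
        positive_definite_form (map_matrix \<sigma> A))"

definition GL_over :: "real set \<Rightarrow> (real^'m^'m::finite) set" where
  "GL_over R = {T. entries_in T R \<and>
                   (\<exists>S. entries_in S R \<and> T ** S = mat 1 \<and> S ** T = mat 1)}"

definition orth_group' :: "real^'m^'m \<Rightarrow> real set \<Rightarrow> (real^'m^'m::finite) set" where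
  "orth_group' A R =
     {T \<in> GL_over R. transpose T ** A ** T = A \<and>
        (\<forall>C \<in> components {x. quad_form A x < 0}. (\<lambda>x. T *v x) ` C = C)}"

definition lorentz_inner :: "real^('n::finite option) \<Rightarrow> real^('n option) \<Rightarrow> real" where
  "lorentz_inner x y = (\<Sum>i\<in>UNIV. x $ Some i * y $ Some i) - x $ None * y $ None"

definition lorentz_form :: "real^('n::finite option) \<Rightarrow> real" where
  "lorentz_form x = (\<Sum>i\<in>UNIV. (x $ Some i)\<^sup>2) - (x $ None)\<^sup>2"

definition hyperboloid :: "(real^('n::finite option)) set" where
  "hyperboloid = {x. lorentz_form x = -1 \<and> 0 < x $ None}"

definition hyp_dist :: "real^('n::finite option) \<Rightarrow> real^('n option) \<Rightarrow> real" where
  "hyp_dist x y = arcosh (- lorentz_inner x y)"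

definition O_plus :: "(real^('n::finite option)^('n option)) set" where
  "O_plus = {T. (\<forall>x. lorentz_form (T *v x) = lorentz_form x) \<and>
                (\<lambda>x. T *v x) ` hyperboloid = hyperboloid}"

definition geodesic_line :: "(real \<Rightarrow> real^('n::finite option)) \<Rightarrow> bool" where
  "geodesic_line c \<longleftrightarrow>
     range c \<subseteq> hyperboloid \<and> (\<forall>s t. hyp_dist (c s) (c t) = \<bar>s - t\<bar>)"

definition translates_along ::
    "real^('n::finite option)^('n option) \<Rightarrow> (real^('n option)) set \<Rightarrow> real \<Rightarrow> bool" where
  "translates_along g L l \<longleftrightarrow>
     0 < l \<and> (\<exists>c. geodesic_line c \<and> range c = L \<and> (\<forall>t. g *v c t = c (t + l)))"

definition hyperbolic_isometry :: "real^('n::finite option)^('n option) \<Rightarrow> bool" where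
  "hyperbolic_isometry g \<longleftrightarrow> g \<in> O_plus \<and> (\<exists>!L. \<exists>l. translates_along g L l)"

definition translation_length :: "real^('n::finite option)^('n option) \<Rightarrow> real" where
  "translation_length g = (THE l. \<exists>L. translates_along g L l)"

definition GL_group :: "(real^'m^'m::finite) monoid" where
  "GL_group = \<lparr>carrier = {T. invertible T}, monoid.mult = (**), one = mat 1\<rparr>"

definition finite_index :: "('a, 'b) monoid_scheme \<Rightarrow> 'a set \<Rightarrow> 'a set \<Rightarrow> bool" where
  "finite_index G H L \<longleftrightarrow> finite (rcosets\<^bsub>G\<lparr>carrier := H\<rparr>\<^esub> L)"

definition commensurable :: "('a, 'b) monoid_scheme \<Rightarrow> 'a set \<Rightarrow> 'a set \<Rightarrow> bool" where
  "commensurable G H L \<longleftrightarrow> finite_index G H (H \<inter> L) \<and> finite_index G L (H \<inter> L)"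

definition simplest_type_lattice ::
    "real set \<Rightarrow> (real^('n::finite option)^('n option)) set \<Rightarrow> bool" where
  "simplest_type_lattice K \<Gamma> \<longleftrightarrow>
     totally_real_number_field K \<and>
     \<Gamma> \<subseteq> O_plus \<and> subgroup \<Gamma> GL_group \<and>
     (\<exists>(A :: real^('n option)^('n option)) (M :: real^('n option)^('n option)).
        admissible_form K A \<and> invertible M \<and>
        (\<forall>x. quad_form A (M *v x) = lorentz_form x) \<and>
        commensurable GL_group ((\<lambda>T. M ** T ** matrix_inv M) ` \<Gamma>)
                               (orth_group' A (ring_of_integers K)))"

end

theory Submission
  imports Defs "Jordan_Normal_Form.Char_Poly"
begin

text \<open>
  Put \<open>t = \<lambda> + 1/\<lambda>\<close>. The binary form \<open>x\<^sup>2 + t x y + y\<^sup>2\<close> is preserved by the matrix with rows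
  \<open>(0, -1)\<close> and \<open>(1, t)\<close>, which has entries in the integers of \<open>\<rat>(t)\<close> and eigenvalues \<open>\<lambda>\<close> and \<open>1/\<lambda>\<close>. The form is
  indefinite since \<open>t > 2\<close>; a nonidentity embedding sends \<open>t\<close> to \<open>z + 1/z\<close> for a conjugate \<open>z\<close>
  of \<open>\<lambda>\<close> on the unit circle, hence into the open interval \<open>(-2, 2)\<close>, and the form becomes
  definite. Adding \<open>n - 1\<close> squares gives an admissible form \<open>f\<close>. For \<open>\<Gamma>\<close> one takes the conjugate of the
  whole group \<open>O'(f)\<close> over the ring of integers into \<open>O\<^sup>+(n,1)\<close>; the matrix above, extended
  by the identity, becomes a Lorentz boost by \<open>ln \<lambda>\<close>.
\<close>

no_notation vec_index (infixl "$" 100)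
unbundle no fps_syntax
no_notation scalar_prod (infix "\<bullet>" 70)
hide_const (open) Matrix.mat Determinant.det Matrix.row Matrix.transpose_mat Matrix.vec
  Polynomials.lead_coeff Polynomials.degree up_ring.coeff

section \<open>Algebraic integers form a ring\<close>

text \<open>Gives access to \<open>int_module.span S\<close>, the additive group generated by
  \<open>S\<close>, so that integrality becomes a finiteness statement.\<close>

interpretation int_module: Modules.module "\<lambda>(k::int) (x::'a::field_char_0). of_int k * x"
  by unfold_locales (auto simp: algebra_simps)

lemma int_span_mult_image:
  fixes c :: "'a::field_char_0"
  assumes "\<And>s. s \<in> S \<Longrightarrow> c * s \<in> int_module.span T" and "z \<in> int_module.span S"
  shows "c * z \<in> int_module.span T"
  using assms(2)
proof (induction rule: int_module.span_induct_alt)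
  case base
  then show ?case by (simp add: int_module.span_zero)
next
  case (step k s z)
  have "of_int k * (c * s) + c * z \<in> int_module.span T"
    using step assms(1) by (intro int_module.span_add int_module.span_scale) auto
  then show ?case by (simp add: algebra_simps)
qed

text \<open>The determinant trick: \<open>x\<close> is an eigenvalue of the integer matrix describing
  multiplication by \<open>x\<close> on the generators \<open>S\<close>.\<close>

lemma algebraic_int_if_mult_stable_span:
  fixes x :: "'a::field_char_0"
  assumes "finite S" and "s0 \<in> S" "s0 \<noteq> 0"
    and stable: "\<And>s. s \<in> S \<Longrightarrow> x * s \<in> int_module.span S"
  shows "algebraic_int x"
proof -
  obtain ss where ss: "set ss = S" "distinct ss"
    using finite_distinct_list[OF assms(1)] by blast
  define n where "n = length ss"
  have "\<exists>N. \<forall>i<n. x * ss ! i = (\<Sum>j<n. of_int (N i j) * ss ! j)"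
  proof -
    have "\<exists>c. x * ss ! i = (\<Sum>j<n. of_int (c j) * ss ! j)" if "i < n" for i
    proof -
      have "x * ss ! i \<in> int_module.span S"
        using that ss stable by (auto simp: n_def)
      then obtain u where u: "x * ss ! i = (\<Sum>s\<in>S. of_int (u s) * s)"
        using int_module.span_finite[OF assms(1)] by auto
      have "bij_betw (\<lambda>j. ss ! j) {..<n} S"
        using ss by (auto simp: n_def intro: bij_betw_nth)
      from sum.reindex_bij_betw[OF this, of "\<lambda>s. of_int (u s) * s"] u
      have "x * ss ! i = (\<Sum>j<n. of_int (u (ss ! j)) * ss ! j)" by simp
      then show ?thesis by (rule exI[of _ "\<lambda>j. u (ss ! j)"])
    qed
    then show ?thesis by metis
  qed
  then obtain N where N: "\<And>i. i < n \<Longrightarrow> x * ss ! i = (\<Sum>j<n. of_int (N i j) * ss ! j)" by blast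
  define A where "A = Matrix.mat n n (\<lambda>(i, j). N i j)"
  have A: "A \<in> carrier_mat n n" by (simp add: A_def)
  define B where "B = map_mat (of_int :: int \<Rightarrow> 'a) A"
  have B: "B \<in> carrier_mat n n" using A by (simp add: B_def)
  define v where "v = Matrix.vec n (\<lambda>i. ss ! i)"
  obtain i0 where i0: "i0 < n" "ss ! i0 = s0"
    using assms(2) ss(1) by (metis in_set_conv_nth n_def)
  have "v \<noteq> 0\<^sub>v n"
    using i0 assms(3) by (metis index_vec index_zero_vec(1) v_def)
  moreover have "B *\<^sub>v v = x \<cdot>\<^sub>v v"
    using N by (intro eq_vecI) (auto simp: B_def A_def v_def scalar_prod_def atLeast0LessThan
        intro!: sum.cong)
  ultimately have "eigenvector B v x"
    using B by (auto simp: eigenvector_def v_def)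
  then have "poly (char_poly B) x = 0"
    using eigenvalue_root_char_poly[OF B] by (auto simp: eigenvalue_def)
  moreover have "char_poly B = map_poly of_int (char_poly A)"
    unfolding B_def by (rule of_int_hom.char_poly_hom[OF A])
  ultimately have "poly (map_poly of_int (char_poly A)) x = 0" by simp
  moreover have "lead_coeff (char_poly A) = 1"
    using degree_monic_char_poly[OF A] by simp
  ultimately show ?thesis
    unfolding algebraic_int_altdef_ipoly by blast
qed

text \<open>The powers of \<open>x\<close> below the degree of a monic relation work: multiplication
  by \<open>x\<close> shifts the exponent, and the relation rewrites the top power.\<close>

lemma algebraic_int_finite_power_span:
  fixes x :: "'a::field_char_0"
  assumes "algebraic_int x"
  obtains S where "finite S" "1 \<in> S" "\<And>s. s \<in> S \<Longrightarrow> x * s \<in> int_module.span S"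
proof -
  obtain p where p: "poly (map_poly of_int p) x = 0" "lead_coeff p = 1"
    using assms by (auto simp: algebraic_int_altdef_ipoly)
  define d where "d = degree p"
  define S where "S = (\<lambda>i. x ^ i) ` {..<d}"
  \<comment> \<open>A positive degree is what puts \<open>1 = x ^ 0\<close> into
    \<open>S\<close>.\<close>
  have "d \<noteq> 0"
  proof
    assume "d = 0"
    then have "p = 1" using p(2) by (metis d_def degree_eq_zeroE lead_coeff_pCons(2) one_pCons)
    with p(1) show False by simp
  qed
  have "x ^ d + (\<Sum>i<d. of_int (coeff p i) * x ^ i) = 0"
  proof -
    have "(\<Sum>i\<le>d. of_int (coeff p i) * x ^ i) = 0"
      using p(1) by (simp add: poly_altdef d_def degree_map_poly coeff_map_poly)
    then show ?thesis
      using p(2) by (simp add: d_def lessThan_Suc_atMost[symmetric] add.commute)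
  qed
  then have "x ^ d = (\<Sum>i<d. of_int (- coeff p i) * x ^ i)"
    by (simp add: sum_negf eq_neg_iff_add_eq_0)
  also have "\<dots> \<in> int_module.span S"
    by (intro int_module.span_sum int_module.span_scale int_module.span_base) (auto simp: S_def)
  finally have top: "x ^ d \<in> int_module.span S" .
  show thesis
  proof
    show "finite S" by (simp add: S_def)
    show "1 \<in> S" using \<open>d \<noteq> 0\<close> by (auto simp: S_def intro!: image_eqI[of _ _ 0])
    show "x * s \<in> int_module.span S" if s: "s \<in> S" for s
    proof -
      obtain i where i: "i < d" "s = x ^ i" using s by (auto simp: S_def)
      show ?thesis
      proof (cases "Suc i = d")
        case True
        then show ?thesis using top i by auto
      next
        case False
        then have "x ^ Suc i \<in> S" using i(1) unfolding S_def by (intro image_eqI[of _ _ "Suc i"]) auto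
        then show ?thesis using i by (simp add: int_module.span_base)
      qed
    qed
  qed
qed

text \<open>Products of generators for \<open>x\<close> with generators for \<open>y\<close> span a
  module stable under both multiplications, hence under those by \<open>x + y\<close> and
  \<open>x * y\<close>.\<close>

lemma algebraic_int_plus_times:
  fixes x y :: "'a::field_char_0"
  assumes "algebraic_int x" "algebraic_int y"
  shows algebraic_int_plus: "algebraic_int (x + y)"
    and algebraic_int_times: "algebraic_int (x * y)"
proof -
  obtain S where S: "finite S" "1 \<in> S" "\<And>s. s \<in> S \<Longrightarrow> x * s \<in> int_module.span S"
    using algebraic_int_finite_power_span[OF assms(1)] by blast
  obtain T where T: "finite T" "1 \<in> T" "\<And>t. t \<in> T \<Longrightarrow> y * t \<in> int_module.span T"
    using algebraic_int_finite_power_span[OF assms(2)] by blast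
  define U where "U = (\<lambda>(s, t). s * t) ` (S \<times> T)"
  have U: "finite U" "1 \<in> U"
    using S T by (auto simp: U_def intro!: image_eqI[of _ _ "(1, 1)"])
  have x: "x * u \<in> int_module.span U" if u: "u \<in> U" for u
  proof -
    obtain s t where st: "s \<in> S" "t \<in> T" "u = s * t" using u by (auto simp: U_def)
    have "t * (x * s) \<in> int_module.span U"
      by (rule int_span_mult_image[OF _ S(3)[OF st(1)]])
        (use st in \<open>auto simp: U_def mult.commute[of t] intro!: int_module.span_base\<close>)
    then show ?thesis using st by (simp add: mult_ac)
  qed
  have y: "y * u \<in> int_module.span U" if u: "u \<in> U" for u
  proof -
    obtain s t where st: "s \<in> S" "t \<in> T" "u = s * t" using u by (auto simp: U_def)
    have "s * (y * t) \<in> int_module.span U"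
      by (rule int_span_mult_image[OF _ T(3)[OF st(2)]])
        (use st in \<open>auto simp: U_def intro!: int_module.span_base\<close>)
    then show ?thesis using st by (simp add: mult_ac)
  qed
  show "algebraic_int (x + y)"
    by (rule algebraic_int_if_mult_stable_span[OF U])
      (auto simp: distrib_right intro!: int_module.span_add x y)
  show "algebraic_int (x * y)"
    by (rule algebraic_int_if_mult_stable_span[OF U])
      (auto simp: mult.assoc intro!: int_span_mult_image[OF x] y)
qed

section \<open>Embeddings of subfields of the reals\<close>

lemma ring_of_type_algebra_simps [simp]:
  "carrier (ring_of_type_algebra :: 'a::comm_ring_1 ring) = UNIV"
  "monoid.mult (ring_of_type_algebra :: 'a ring) x y = x * y"
  "one (ring_of_type_algebra :: 'a ring) = 1"
  "zero (ring_of_type_algebra :: 'a ring) = 0"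
  "add (ring_of_type_algebra :: 'a ring) x y = x + y"
  by (simp_all add: ring_of_type_algebra_def)

lemma ring_of_type_algebra_a_inv [simp]:
  "a_inv (ring_of_type_algebra :: 'a::comm_ring_1 ring) x = - x"
proof -
  interpret cring "ring_of_type_algebra :: 'a ring" by (rule cring_from_type_algebra)
  show ?thesis by (rule minus_equality) auto
qed

lemma ring_of_type_algebra_m_inv [simp]:
  "x \<noteq> 0 \<Longrightarrow> m_inv (ring_of_type_algebra :: 'a::field ring) x = inverse x"
proof -
  interpret field "ring_of_type_algebra :: 'a ring" by (rule field_from_type_algebra)
  show "x \<noteq> 0 \<Longrightarrow> ?thesis" by (rule inv_char) auto
qed

lemma subfield_closed:
  fixes K :: "'a::field_char_0 set"
  assumes K: "subfield K ring_of_type_algebra"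
  shows subfield_0: "0 \<in> K" and subfield_1: "1 \<in> K"
    and subfield_add: "x \<in> K \<Longrightarrow> y \<in> K \<Longrightarrow> x + y \<in> K"
    and subfield_mult: "x \<in> K \<Longrightarrow> y \<in> K \<Longrightarrow> x * y \<in> K"
    and subfield_uminus: "x \<in> K \<Longrightarrow> - x \<in> K"
    and subfield_inverse: "x \<in> K \<Longrightarrow> inverse x \<in> K"
    and subfield_of_rat: "of_rat q \<in> K"
proof -
  interpret field "ring_of_type_algebra :: 'a ring" by (rule field_from_type_algebra)
  note sub = subringE[OF subfieldE(1)[OF K]]
  show 0: "0 \<in> K" and 1: "1 \<in> K"
    using sub(2,3) by simp_all
  show add: "x + y \<in> K" if "x \<in> K" "y \<in> K" for x y
    using sub(7)[OF that] by simp
  show mult: "x * y \<in> K" if "x \<in> K" "y \<in> K" for x y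
    using sub(6)[OF that] by simp
  show uminus: "- x \<in> K" if "x \<in> K" for x
    using sub(5)[OF that] by simp
  show inverse: "inverse x \<in> K" if "x \<in> K" for x
    using subfield_m_inv(1)[OF K, of x] that 0 by (cases "x = 0") auto
  have nat: "of_nat n \<in> K" for n
    by (induction n) (auto intro: 0 1 add)
  have int: "of_int i \<in> K" for i
    by (cases i rule: int_cases2) (auto intro: nat uminus)
  show "of_rat q \<in> K"
    by (cases q) (auto simp: of_rat_rat field_class.field_divide_inverse intro: int mult inverse)
qed

text \<open>An embedding is constrained only on \<open>K\<close>, hence the membership premises.
  Rational numbers are fixed because field operations build them from 1.\<close>

lemma field_embedding_hom:
  fixes \<sigma> :: "real \<Rightarrow> 'a::field_char_0"
  assumes K: "subfield K real_ring" and \<sigma>: "\<sigma> \<in> field_embeddings K"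
  shows field_embedding_add: "x \<in> K \<Longrightarrow> y \<in> K \<Longrightarrow> \<sigma> (x + y) = \<sigma> x + \<sigma> y"
    and field_embedding_mult: "x \<in> K \<Longrightarrow> y \<in> K \<Longrightarrow> \<sigma> (x * y) = \<sigma> x * \<sigma> y"
    and field_embedding_0: "\<sigma> 0 = 0"
    and field_embedding_1: "\<sigma> 1 = 1"
    and field_embedding_uminus: "x \<in> K \<Longrightarrow> \<sigma> (- x) = - \<sigma> x"
    and field_embedding_inverse: "x \<in> K \<Longrightarrow> \<sigma> (inverse x) = inverse (\<sigma> x)"
    and field_embedding_of_rat: "\<sigma> (of_rat q) = of_rat q"
proof -
  note closed = subfield_closed[OF K]
  show add: "\<sigma> (x + y) = \<sigma> x + \<sigma> y" and mult: "\<sigma> (x * y) = \<sigma> x * \<sigma> y"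
    if "x \<in> K" "y \<in> K" for x y
    using \<sigma> that by (auto simp: field_embeddings_def Ring.ring_hom_def)
  show one: "\<sigma> 1 = 1"
    using \<sigma> by (auto simp: field_embeddings_def Ring.ring_hom_def)
  show zero: "\<sigma> 0 = 0"
    using add[OF closed(1) closed(1)] by simp
  show uminus: "\<sigma> (- x) = - \<sigma> x" if "x \<in> K" for x
    using add[OF that closed(5)[OF that]] zero by (simp add: eq_neg_iff_add_eq_0 add.commute)
  show inverse: "\<sigma> (inverse x) = inverse (\<sigma> x)" if "x \<in> K" for x
  proof (cases "x = 0")
    case False
    then have "\<sigma> x * \<sigma> (inverse x) = 1"
      using mult[OF that closed(6)[OF that]] one by simp
    then show ?thesis by (metis inverse_unique)
  qed (simp add: zero)
  have nat_K: "of_nat n \<in> K" and int_K: "of_int i \<in> K" for n i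
    using closed(7)[of "of_nat n"] closed(7)[of "of_int i"] by simp_all
  have nat: "\<sigma> (of_nat n) = of_nat n" for n
    by (induction n) (simp_all add: zero one add closed nat_K)
  have int: "\<sigma> (of_int i) = of_int i" for i
    by (cases i rule: int_cases2) (simp_all add: nat uminus nat_K)
  show "\<sigma> (of_rat q) = of_rat q"
    by (cases q) (simp add: of_rat_rat field_class.field_divide_inverse mult inverse int int_K closed)
qed

lemma field_embedding_eq_0_iff:
  fixes \<sigma> :: "real \<Rightarrow> 'a::field_char_0"
  assumes "subfield K real_ring" "\<sigma> \<in> field_embeddings K" "x \<in> K"
  shows "\<sigma> x = 0 \<longleftrightarrow> x = 0"
proof
  assume 0: "\<sigma> x = 0"
  show "x = 0"
  proof (rule ccontr)
    assume "x \<noteq> 0"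
    then have "\<sigma> x * \<sigma> (inverse x) = 1"
      using field_embedding_mult[OF assms(1,2,3), of "inverse x"] assms
      by (simp add: subfield_inverse field_embedding_1)
    with 0 show False by simp
  qed
qed (use assms in \<open>simp add: field_embedding_0\<close>)

section \<open>The field generated by one real number\<close>

lemma subfield_rat_adjoin: "subfield (rat_adjoin x) real_ring"
  unfolding rat_adjoin_def
  by (rule field.generate_field_is_subfield) (auto intro: field_from_type_algebra)

lemma rat_adjoin_self: "x \<in> rat_adjoin x"
  unfolding rat_adjoin_def by (rule generate_field.incl) simp

text \<open>Membership is kept beside \<open>P\<close> in the inductive cases because the rules for
  embeddings hold only inside the field.\<close>

lemma rat_adjoin_induct [consumes 1, case_names one gen uminus inverse add mult]:
  assumes "y \<in> rat_adjoin x"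
    and "P 1" "P x" "\<And>y. y \<in> rat_adjoin x \<Longrightarrow> P y \<Longrightarrow> P (- y)"
    and "\<And>y. y \<in> rat_adjoin x \<Longrightarrow> P y \<Longrightarrow> P (inverse y)"
    and "\<And>y z. y \<in> rat_adjoin x \<Longrightarrow> z \<in> rat_adjoin x \<Longrightarrow> P y \<Longrightarrow> P z \<Longrightarrow> P (y + z)"
    and "\<And>y z. y \<in> rat_adjoin x \<Longrightarrow> z \<in> rat_adjoin x \<Longrightarrow> P y \<Longrightarrow> P z \<Longrightarrow> P (y * z)"
  shows "P y"
  using assms(1) unfolding rat_adjoin_def
  by (induction rule: generate_field.induct) (use assms(2-) in \<open>auto simp: rat_adjoin_def\<close>)

lemma subfield_Rats: "subfield \<rat> real_ring"
proof -
  interpret field real_ring by (rule field_from_type_algebra)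
  show ?thesis
  proof (rule subfieldI')
    show "subring \<rat> real_ring" by (rule subringI) auto
  qed auto
qed

text \<open>Polynomials in HOL-Algebra are lists with the leading coefficient first, while
  \<open>coeffs\<close> begins with the constant term.\<close>

lemma eval_rev_coeffs:
  fixes x :: "'a::field"
  shows "ring.eval ring_of_type_algebra (rev (coeffs p)) x = poly p x"
proof -
  interpret field "ring_of_type_algebra :: 'a ring" by (rule field_from_type_algebra)
  show ?thesis
    by (induction p) (auto simp: eval_append_aux cCons_def algebra_simps)
qed

lemma algebraic_over_Rats:
  assumes "algebraic_int x"
  shows "(ring.algebraic real_ring over \<rat>) x"
proof -
  obtain p where p: "poly p x = 0" "lead_coeff p = 1" "\<And>i. coeff p i \<in> \<int>"
    using assms by (auto simp: algebraic_int.simps)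
  interpret field real_ring by (rule field_from_type_algebra)
  have "p \<noteq> 0" using p(2) by auto
  show ?thesis
  proof (rule algebraicI)
    show "rev (coeffs p) \<in> carrier (\<rat> [X]\<^bsub>real_ring\<^esub>)"
      using p \<open>p \<noteq> 0\<close> Ints_subset_Rats
      by (auto simp: univ_poly_def polynomial_def hd_rev last_coeffs_eq_coeff_degree
          coeffs_def set_upt split: if_splits)
    show "rev (coeffs p) \<noteq> []" using \<open>p \<noteq> 0\<close> by simp
    show "eval (rev (coeffs p)) x = \<zero>\<^bsub>real_ring\<^esub>" by (simp add: eval_rev_coeffs p(1))
  qed
qed

text \<open>For algebraic \<open>x\<close> the polynomial expressions in \<open>x\<close> already
  form a field, so the generated field is \<open>simple_extension \<rat> x\<close>.\<close>

lemma finite_dimension_rat_adjoin: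
  assumes "algebraic_int x"
  shows "ring.finite_dimension real_ring \<rat> (rat_adjoin x)"
proof -
  interpret field real_ring by (rule field_from_type_algebra)
  note alg = algebraic_over_Rats[OF assms]
  have sub: "subfield (simple_extension \<rat> x) real_ring"
    using simple_extension_is_subfield[OF subfield_Rats] alg by simp
  have "rat_adjoin x = simple_extension \<rat> x"
  proof
    show "rat_adjoin x \<subseteq> simple_extension \<rat> x"
      unfolding rat_adjoin_def
      using sub simple_extension_mem[OF subfieldE(1)[OF subfield_Rats], of x]
      by (intro generate_field_min_subfield1) auto
    show "simple_extension \<rat> x \<subseteq> rat_adjoin x"
      using subfield_of_rat[OF subfield_rat_adjoin] rat_adjoin_self
      by (intro simple_extension_subring_incl subfieldE(1) subfield_rat_adjoin)
        (auto elim!: Rats_cases)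
  qed
  then show ?thesis
    using finite_dimension_simple_extension[OF subfield_Rats, of x] alg by simp
qed

section \<open>The trace field of a Salem number\<close>

text \<open>Chebyshev polynomials of the second kind with shifted index:
  \<open>cheb t (n + 1)\<close> is \<open>U\<^sub>n(t/2)\<close>.\<close>

fun cheb :: "'a::comm_ring_1 \<Rightarrow> nat \<Rightarrow> 'a" where
  "cheb t 0 = 0"
| "cheb t (Suc 0) = 1"
| "cheb t (Suc (Suc n)) = t * cheb t (Suc n) - cheb t n"

text \<open>Reduces powers of \<open>x\<close> modulo its quadratic equation. The coefficients
  depend on \<open>t\<close> alone, so an embedding of a field containing \<open>t\<close> can act
  on them.\<close>

lemma power_Suc_eq_cheb:
  assumes "x * x = t * x - 1"
  shows "x ^ Suc n = cheb t (Suc n) * x - cheb t n"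
proof (induction n)
  case (Suc n)
  have "x ^ Suc (Suc n) = (cheb t (Suc n) * x - cheb t n) * x"
    unfolding Suc[symmetric] by (simp add: mult.commute)
  also have "\<dots> = cheb t (Suc n) * (x * x) - cheb t n * x"
    by (simp add: algebra_simps)
  also have "\<dots> = cheb t (Suc (Suc n)) * x - cheb t (Suc n)"
    unfolding assms by (simp add: algebra_simps)
  finally show ?case .
qed simp

text \<open>\<open>cheb_comb p t 1\<close> and \<open>- cheb_comb p t 0\<close> are the coefficients
  of the remainder of \<open>X p(X)\<close> modulo \<open>X\<^sup>2 - t X + 1\<close>. The factor
  \<open>X\<close> keeps the index of \<open>cheb\<close> nonnegative.\<close>

definition cheb_comb :: "rat poly \<Rightarrow> 'a::field_char_0 \<Rightarrow> nat \<Rightarrow> 'a" where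
  "cheb_comb p t k = (\<Sum>i\<le>degree p. of_rat (coeff p i) * cheb t (i + k))"

lemma poly_of_rat_times_eq_cheb_comb:
  fixes x :: "'a::field_char_0"
  assumes "x * x = t * x - 1"
  shows "poly (map_poly of_rat p) x * x = cheb_comb p t 1 * x - cheb_comb p t 0"
proof -
  have "poly (map_poly of_rat p) x * x = (\<Sum>i\<le>degree p. of_rat (coeff p i) * x ^ Suc i)"
    by (simp add: poly_altdef degree_map_poly coeff_map_poly sum_distrib_left sum_distrib_right mult_ac)
  also have "\<dots> = (\<Sum>i\<le>degree p. of_rat (coeff p i) * (cheb t (Suc i) * x - cheb t i))"
    by (simp only: power_Suc_eq_cheb[OF assms])
  also have "\<dots> = cheb_comb p t 1 * x - cheb_comb p t 0"
    by (simp add: cheb_comb_def sum_distrib_left algebra_simps sum_subtractf)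
  finally show ?thesis .
qed

lemma field_embedding_cheb_comb:
  fixes \<sigma> :: "real \<Rightarrow> 'a::field_char_0"
  assumes K: "subfield K real_ring" and \<sigma>: "\<sigma> \<in> field_embeddings K" and t: "t \<in> K"
  shows "\<sigma> (cheb_comb p t k) = cheb_comb p (\<sigma> t) k"
proof -
  note closed = subfield_closed[OF K] and hom = field_embedding_hom[OF K \<sigma>]
  have diff: "x - y \<in> K" "\<sigma> (x - y) = \<sigma> x - \<sigma> y" if "x \<in> K" "y \<in> K" for x y
    using closed(3)[OF that(1) closed(5)[OF that(2)]] hom(1)[OF that(1) closed(5)[OF that(2)]]
      hom(5)[OF that(2)] by simp_all
  have cheb: "cheb t n \<in> K \<and> \<sigma> (cheb t n) = cheb (\<sigma> t) n" for n
  proof (induction n rule: induct_nat_012)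
    case (ge2 n)
    then show ?case using t by (simp add: closed hom diff)
  qed (simp_all add: closed hom)
  have sum: "sum f I \<in> K \<and> \<sigma> (sum f I) = (\<Sum>i\<in>I. \<sigma> (f i))"
    if "finite I" "\<And>i. i \<in> I \<Longrightarrow> f i \<in> K" for f :: "nat \<Rightarrow> real" and I
    using that by (induction I rule: finite_induct) (auto simp: closed hom)
  show ?thesis
    unfolding cheb_comb_def using cheb
    by (subst sum[THEN conjunct2]) (auto simp: closed hom)
qed

text \<open>\<open>X\<^sup>2 - t X + 1\<close> divides a rational polynomial vanishing at both \<open>x\<close> and its inverse;
  applying an embedding of \<open>\<rat>(t)\<close> to the cofactor shows that the roots of the
  conjugate quadratic are again roots.\<close>

lemma root_of_embedded_quadratic:
  fixes \<sigma> :: "real \<Rightarrow> 'a::field_char_0"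
  assumes K: "subfield K real_ring" and \<sigma>: "\<sigma> \<in> field_embeddings K"
    and t: "x + inverse x \<in> K" and x: "x \<noteq> 0" "x \<noteq> inverse x"
    and roots: "poly (map_poly of_rat p) x = 0" "poly (map_poly of_rat p) (inverse x) = 0"
    and z: "z * z = \<sigma> (x + inverse x) * z - 1"
  shows "poly (map_poly of_rat p) z = 0"
proof -
  define t where "t = x + inverse x"
  have eq: "cheb_comb p t 1 * y = cheb_comb p t 0" if "y = x \<or> y = inverse x" for y
  proof -
    have "y * y = t * y - 1" using that x by (auto simp: t_def algebra_simps)
    from poly_of_rat_times_eq_cheb_comb[OF this, of p] show ?thesis using roots that by auto
  qed
  \<comment> \<open>The linear remainder vanishes at the distinct points \<open>x\<close> and
    \<open>inverse x\<close>, so both coefficients are zero.\<close>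
  have "cheb_comb p t 1 * (x - inverse x) = 0"
    using eq[of x] eq[of "inverse x"] by (simp add: algebra_simps)
  then have 1: "cheb_comb p t 1 = 0" using x by simp
  then have 0: "cheb_comb p t 0 = 0" using eq[of x] by simp
  have "cheb_comb p (\<sigma> t) 1 = 0" "cheb_comb p (\<sigma> t) 0 = 0"
    using field_embedding_cheb_comb[OF K \<sigma> t, folded t_def, of p 1]
      field_embedding_cheb_comb[OF K \<sigma> t, folded t_def, of p 0] field_embedding_0[OF K \<sigma>] 0 1
    by simp_all
  then have "poly (map_poly of_rat p) z * z = 0"
    using poly_of_rat_times_eq_cheb_comb[OF z, of p] by (simp add: t_def)
  moreover have "z \<noteq> 0" using z by auto
  ultimately show ?thesis by simp
qed

section \<open>Conjugates and traces of Salem numbers\<close>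

lemma poly_of_rat_of_real:
  "poly (map_poly of_rat p) (complex_of_real x) = complex_of_real (poly (map_poly of_rat p) x)"
proof -
  have "complex_of_real (of_rat q) = of_rat q" for q
    by (cases q) (simp add: of_rat_rat)
  then show ?thesis
    by (simp add: poly_altdef degree_map_poly coeff_map_poly)
qed

interpretation of_rat_poly_hom: map_poly_comm_ring_hom "of_rat :: rat \<Rightarrow> 'a::field_char_0" ..

text \<open>Otherwise \<open>p\<close> and \<open>q\<close> are coprime, and a Bezout identity
  evaluated at the common root reads 0 = 1.\<close>

lemma irreducible_rat_poly_dvd:
  fixes p q :: "rat poly" and x :: "'a::field_char_0"
  assumes "Factorial_Ring.irreducible p"
    and "poly (map_poly of_rat p) x = 0" "poly (map_poly of_rat q) x = 0"
  shows "p dvd q"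
proof (rule ccontr)
  assume "\<not> p dvd q"
  then have "Rings.coprime p q"
    using assms(1) by (metis prime_elem_imp_coprime irreducible_imp_prime_elem)
  then obtain r s where "r * p + s * q = 1"
    using bezout_coefficients_fst_snd[of p q] by auto
  then have "poly (map_poly of_rat (r * p + s * q)) x = 1" by simp
  then show False
    using assms(2,3) by (simp add: of_rat_poly_hom.hom_add of_rat_poly_hom.hom_mult)
qed

lemma salem_number_inverse_root:
  assumes "salem_number lam"
  obtains p where "Factorial_Ring.irreducible p"
    "poly (map_poly of_rat p) lam = 0" "poly (map_poly of_rat p) (inverse lam) = 0"
proof -
  have "complex_of_real (inverse lam) \<in> rat_conjugates lam"
    using assms by (simp add: salem_number_def)
  then obtain p where "Factorial_Ring.irreducible p" "poly (map_poly of_rat p) lam = 0"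
    "poly (map_poly of_rat p) (complex_of_real (inverse lam)) = 0"
    unfolding rat_conjugates_def by blast
  then show thesis using that by (simp only: poly_of_rat_of_real of_real_eq_0_iff)
qed

text \<open>A monic integer polynomial vanishing at \<open>lam\<close> is a multiple of the
  irreducible \<open>p\<close>, so it vanishes at \<open>inverse lam\<close> too; both are then
  algebraic integers.\<close>

lemma salem_number_algebraic_int_trace:
  assumes "salem_number lam"
  shows "algebraic_int (lam + inverse lam)"
proof -
  obtain p where p: "Factorial_Ring.irreducible p"
    "poly (map_poly of_rat p) lam = 0" "poly (map_poly of_rat p) (inverse lam) = 0"
    using salem_number_inverse_root[OF assms] .
  have int: "algebraic_int lam" using assms by (simp add: salem_number_def)
  then obtain q where q: "poly (map_poly of_int q) lam = 0" "lead_coeff q = 1"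
    by (auto simp: algebraic_int_altdef_ipoly)
  define q' where "q' = map_poly (of_int :: int \<Rightarrow> rat) q"
  have q': "map_poly of_rat q' = map_poly (of_int :: int \<Rightarrow> real) q"
    by (simp add: q'_def map_poly_map_poly o_def)
  have "p dvd q'" by (rule irreducible_rat_poly_dvd[OF p(1,2)]) (simp add: q' q(1))
  then obtain r where "q' = p * r" by blast
  then have "poly (map_poly of_rat q') (inverse lam) = 0"
    using p(3) by (simp add: of_rat_poly_hom.hom_mult)
  then have "algebraic_int (inverse lam)"
    using q(2) q' by (auto simp: algebraic_int_altdef_ipoly intro!: exI[of _ q])
  then show ?thesis using int by (intro algebraic_int_plus)
qed

text \<open>The image of the trace is \<open>z + inverse z\<close> for a conjugate \<open>z\<close>
  of \<open>lam\<close>. If \<open>z\<close> is neither \<open>lam\<close> nor its inverse, it lies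
  on the unit circle and the sum is twice its real part.\<close>

lemma salem_number_embedded_trace:
  fixes \<sigma> :: "real \<Rightarrow> complex"
  assumes salem: "salem_number lam" and \<sigma>: "\<sigma> \<in> field_embeddings (rat_adjoin (lam + inverse lam))"
  shows "\<sigma> (lam + inverse lam) = of_real (lam + inverse lam) \<or>
         (\<exists>r. \<bar>r\<bar> \<le> 2 \<and> \<sigma> (lam + inverse lam) = complex_of_real r)"
proof -
  define t where "t = \<sigma> (lam + inverse lam)"
  \<comment> \<open>The quadratic formula for \<open>X\<^sup>2 - t X + 1\<close>; here
    \<open>t\<close> may still be any complex number, hence \<open>csqrt\<close>.\<close>
  define z where "z = (t + csqrt (t\<^sup>2 - 4)) / 2"
  have z: "z * z = t * z - 1"
  proof -
    have "(2 * z - t)\<^sup>2 = t\<^sup>2 - 4" by (simp add: z_def)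
    then have "4 * (z * z) = 4 * (t * z - 1)" by (simp add: power2_eq_square algebra_simps)
    then show ?thesis by (metis mult_cancel_left zero_neq_numeral)
  qed
  then have "z \<noteq> 0" by auto
  then have "t * z = (z + inverse z) * z" using z by (simp add: distrib_right)
  with \<open>z \<noteq> 0\<close> have t: "t = z + inverse z" by simp
  obtain p where p: "Factorial_Ring.irreducible p"
    "poly (map_poly of_rat p) lam = 0" "poly (map_poly of_rat p) (inverse lam) = 0"
    using salem_number_inverse_root[OF salem] .
  have lam: "1 < lam" using salem by (simp add: salem_number_def)
  then have "inverse lam < 1" by (simp add: field_simps)
  with lam have "lam \<noteq> 0" "lam \<noteq> inverse lam" by auto
  then have "poly (map_poly of_rat p) z = 0"
    using root_of_embedded_quadratic[OF subfield_rat_adjoin \<sigma> rat_adjoin_self _ _ p(2,3)] z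
    by (simp add: t_def)
  then have conj: "z \<in> rat_conjugates lam"
    using p by (auto simp: rat_conjugates_def)
  show ?thesis
  proof (cases "z \<in> {complex_of_real lam, complex_of_real (inverse lam)}")
    case True
    then have "t = of_real (lam + inverse lam)" unfolding t by auto
    then show ?thesis by (simp add: t_def)
  next
    case False
    then have norm: "cmod z = 1" using salem conj by (auto simp: salem_number_def)
    have "z * cnj z = 1" using complex_norm_square[of z] norm by simp
    then have "inverse z = cnj z" by (rule inverse_unique)
    then have "t = of_real (2 * Re z)" unfolding t by (simp add: complex_add_cnj)
    moreover have "\<bar>2 * Re z\<bar> \<le> 2" using abs_Re_le_cmod[of z] norm by simp
    ultimately show ?thesis unfolding t_def by blast
  qed
qed

lemma field_embedding_Reals_rat_adjoin:
  fixes \<sigma> :: "real \<Rightarrow> complex"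
  assumes \<sigma>: "\<sigma> \<in> field_embeddings (rat_adjoin x)" and "\<sigma> x \<in> \<real>"
  shows "\<sigma> ` rat_adjoin x \<subseteq> \<real>"
proof clarify
  fix y assume "y \<in> rat_adjoin x"
  then show "\<sigma> y \<in> \<real>"
    by (induction rule: rat_adjoin_induct)
      (use assms(2) in \<open>simp_all add: field_embedding_hom[OF subfield_rat_adjoin \<sigma>]\<close>)
qed

text \<open>Used in the contrapositive: a nonidentity embedding must move the generator.\<close>

lemma field_embedding_rat_adjoin_id:
  fixes \<sigma> :: "real \<Rightarrow> real"
  assumes \<sigma>: "\<sigma> \<in> field_embeddings (rat_adjoin x)" and "\<sigma> x = x" and "y \<in> rat_adjoin x"
  shows "\<sigma> y = y"
  using assms(3)
  by (induction rule: rat_adjoin_induct)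
    (use assms(2) in \<open>simp_all add: field_embedding_hom[OF subfield_rat_adjoin \<sigma>]\<close>)

lemma salem_number_totally_real:
  assumes "salem_number lam"
  shows "totally_real_number_field (rat_adjoin (lam + inverse lam))"
proof -
  have "\<sigma> ` rat_adjoin (lam + inverse lam) \<subseteq> \<real>"
    if \<sigma>: "\<sigma> \<in> field_embeddings (rat_adjoin (lam + inverse lam))" for \<sigma> :: "real \<Rightarrow> complex"
  proof (rule field_embedding_Reals_rat_adjoin[OF \<sigma>])
    show "\<sigma> (lam + inverse lam) \<in> \<real>"
      using salem_number_embedded_trace[OF assms \<sigma>] by (elim disjE exE conjE) (simp_all only: Reals_of_real)
  qed
  then show ?thesis
    unfolding totally_real_number_field_def
    by (intro conjI allI impI subfield_rat_adjoin finite_dimension_rat_adjoin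
        salem_number_algebraic_int_trace assms)
qed

text \<open>The product of the positive factors \<open>lam - 1\<close> and
  \<open>1 - inverse lam\<close> expands to the trace minus 2.\<close>

lemma salem_number_trace_gt_2:
  assumes "salem_number lam"
  shows "lam + inverse lam > 2"
proof -
  have "lam > 1" using assms by (simp add: salem_number_def)
  then have "inverse lam < 1" by (simp add: inverse_less_1_iff)
  with \<open>lam > 1\<close> have "0 < (lam - 1) * (1 - inverse lam)" by simp
  also have "\<dots> = lam + inverse lam - (1 + lam * inverse lam)" by (simp only: algebra_simps)
  also have "lam * inverse lam = 1" using \<open>lam > 1\<close> by simp
  finally show ?thesis by simp
qed

text \<open>Embeddings are injective and fix the rational numbers.\<close>

lemma field_embedding_neq_of_rat:
  fixes \<sigma> :: "real \<Rightarrow> 'a::field_char_0"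
  assumes K: "subfield K real_ring" and \<sigma>: "\<sigma> \<in> field_embeddings K" and t: "t \<in> K" "t \<noteq> of_rat q"
  shows "\<sigma> t \<noteq> of_rat q"
proof
  assume "\<sigma> t = of_rat q"
  then have "\<sigma> (t + of_rat (- q)) = 0"
    using field_embedding_add[OF K \<sigma> t(1) subfield_of_rat[OF K], of "- q"]
      field_embedding_of_rat[OF K \<sigma>, of "- q"] by (simp add: of_rat_minus)
  then show False
    using field_embedding_eq_0_iff[OF K \<sigma> subfield_add[OF K t(1) subfield_of_rat[OF K, of "- q"]]] t(2)
    by (simp add: of_rat_minus)
qed

lemma salem_number_real_embedded_trace:
  fixes \<sigma> :: "real \<Rightarrow> real"
  assumes salem: "salem_number lam" and \<sigma>: "\<sigma> \<in> field_embeddings (rat_adjoin (lam + inverse lam))"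
    and neq: "\<sigma> (lam + inverse lam) \<noteq> lam + inverse lam"
  shows "\<bar>\<sigma> (lam + inverse lam)\<bar> < 2"
proof -
  have "complex_of_real \<circ> \<sigma> \<in> field_embeddings (rat_adjoin (lam + inverse lam))"
    using \<sigma> by (auto simp: field_embeddings_def Ring.ring_hom_def)
  from salem_number_embedded_trace[OF salem this]
  have le: "\<bar>\<sigma> (lam + inverse lam)\<bar> \<le> 2"
    using neq by (simp only: o_apply of_real_eq_iff) blast
  \<comment> \<open>The trace exceeds 2, so its image avoids the rational numbers 2 and -2 and the
    bound becomes strict.\<close>
  note neq_rat = field_embedding_neq_of_rat[OF subfield_rat_adjoin \<sigma> rat_adjoin_self]
  have "\<sigma> (lam + inverse lam) \<noteq> 2" "\<sigma> (lam + inverse lam) \<noteq> - 2"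
    using neq_rat[of 2] neq_rat[of "-2"] salem_number_trace_gt_2[OF salem]
    by (auto simp only: of_rat_minus of_rat_numeral_eq)
  with le show ?thesis by linarith
qed

section \<open>Lorentz boosts\<close>

text \<open>Boosts, the quadratic form and the base changes all have this shape, so matrix
  identities reduce to two by two blocks.\<close>

definition plane_block :: "'n::finite \<Rightarrow> real \<Rightarrow> real \<Rightarrow> real \<Rightarrow> real \<Rightarrow> real^('n option)^('n option)" where
  "plane_block k a b c d = (\<chi> i j.
     if i = Some k then (if j = Some k then a else if j = None then b else 0)
     else if i = None then (if j = Some k then c else if j = None then d else 0)
     else if i = j then 1 else 0)"

lemma sum_UNIV_option:
  fixes f :: "'n::finite option \<Rightarrow> 'a::comm_monoid_add"
  shows "(\<Sum>i\<in>UNIV. f i) = f None + (\<Sum>i\<in>UNIV. f (Some i))"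
  by (simp add: UNIV_option_conv sum.reindex)

lemma plane_block_mult_vec:
  "(plane_block k a b c d *v x) $ None = c * x $ Some k + d * x $ None"
  "(plane_block k a b c d *v x) $ Some i =
     (if i = k then a * x $ Some k + b * x $ None else x $ Some i)"
  by (simp_all add: matrix_vector_mult_def plane_block_def sum_UNIV_option if_distrib[of "\<lambda>y. y * _"]
      cong: if_cong)

lemma plane_block_mult:
  "plane_block k a b c d ** plane_block k a' b' c' d' =
   plane_block k (a * a' + b * c') (a * b' + b * d') (c * a' + d * c') (c * b' + d * d')"
  by (subst matrix_eq, subst Finite_Cartesian_Product.vec_eq_iff, rule allI, rule allI)
    (case_tac i; simp add: matrix_vector_mul_assoc[symmetric] plane_block_mult_vec algebra_simps)

lemma plane_block_id: "plane_block k 1 0 0 1 = mat 1"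
  by (subst matrix_eq, subst Finite_Cartesian_Product.vec_eq_iff, rule allI, rule allI)
    (case_tac i; simp add: plane_block_mult_vec)

text \<open>On the hyperboloid this is the squared \<open>sinh\<close> of the distance to the axis
  of the boosts.\<close>

definition off_plane :: "'n::finite \<Rightarrow> real^('n option) \<Rightarrow> real" where
  "off_plane k x = (\<Sum>i\<in>UNIV - {k}. (x $ Some i)\<^sup>2)"

lemma off_plane_nonneg: "0 \<le> off_plane k x"
  by (simp add: off_plane_def sum_nonneg)

lemma off_plane_plane_block [simp]: "off_plane k (plane_block k a b c d *v x) = off_plane k x"
  by (simp add: off_plane_def plane_block_mult_vec)

lemma off_plane_eq_0_iff: "off_plane k x = 0 \<longleftrightarrow> (\<forall>i. i \<noteq> k \<longrightarrow> x $ Some i = 0)"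
  unfolding off_plane_def by (subst sum_nonneg_eq_0_iff) auto

lemma lorentz_form_eq_off_plane:
  "lorentz_form x = off_plane k x + (x $ Some k)\<^sup>2 - (x $ None)\<^sup>2"
  unfolding lorentz_form_def off_plane_def by (subst sum.remove[of _ k]) auto

definition boost :: "'n::finite \<Rightarrow> real \<Rightarrow> real^('n option)^('n option)" where
  "boost k l = plane_block k (cosh l) (sinh l) (sinh l) (cosh l)"

lemma boost_boost: "boost k l *v (boost k m *v x) = boost k (l + m) *v x"
  by (simp add: boost_def matrix_vector_mul_assoc plane_block_mult sinh_add cosh_add algebra_simps)

lemma boost_0: "boost k 0 = mat 1"
  by (simp add: boost_def plane_block_id)

lemma lorentz_form_boost [simp]: "lorentz_form (boost k l *v x) = lorentz_form x"
proof -
  have "(cosh l * a + sinh l * b)\<^sup>2 - (sinh l * a + cosh l * b)\<^sup>2 = a\<^sup>2 - b\<^sup>2" for a b :: real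
  proof -
    have "(cosh l * a + sinh l * b)\<^sup>2 - (sinh l * a + cosh l * b)\<^sup>2
          = ((cosh l)\<^sup>2 - (sinh l)\<^sup>2) * (a\<^sup>2 - b\<^sup>2)" by (simp add: power2_eq_square algebra_simps)
    then show ?thesis by (simp add: hyperbolic_pythagoras)
  qed
  from this[of "x $ Some k" "x $ None"] show ?thesis
    unfolding lorentz_form_eq_off_plane[of _ k] boost_def
    by (simp add: plane_block_mult_vec)
qed

text \<open>In the future cone the last coordinate dominates \<open>\<bar>x $ Some k\<bar>\<close>,
  and \<open>cosh l\<close> dominates \<open>\<bar>sinh l\<bar>\<close>, so the sign cannot
  change.\<close>

lemma boost_None_pos:
  assumes "lorentz_form x < 0" "0 < x $ None"
  shows "0 < (boost k l *v x) $ None"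
proof -
  have "(x $ Some k)\<^sup>2 < (x $ None)\<^sup>2"
    using assms(1) off_plane_nonneg[of k x] by (simp add: lorentz_form_eq_off_plane[of _ k])
  then have lt: "\<bar>x $ Some k\<bar> < x $ None"
    using assms(2) by (metis abs_le_square_iff abs_of_pos not_le)
  have "\<bar>sinh l\<bar> \<le> cosh l"
    using abs_le_square_iff[of "sinh l" "cosh l"] cosh_square_eq[of l] by simp
  then have "\<bar>sinh l * x $ Some k\<bar> \<le> cosh l * \<bar>x $ Some k\<bar>"
    by (simp add: abs_mult mult_right_mono)
  also have "\<dots> < cosh l * x $ None" using lt by simp
  finally show ?thesis by (simp add: boost_def plane_block_mult_vec)
qed

lemma boost_in_O_plus: "boost k l \<in> O_plus"
proof -
  have sub: "(\<lambda>x. boost k m *v x) ` hyperboloid \<subseteq> hyperboloid" for m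
    by (auto simp: hyperboloid_def intro!: boost_None_pos)
  have "x \<in> (\<lambda>x. boost k l *v x) ` hyperboloid" if "x \<in> hyperboloid" for x
    by (rule image_eqI[of _ _ "boost k (- l) *v x"])
      (use that sub[of "- l"] in \<open>auto simp: boost_boost boost_0\<close>)
  then show ?thesis using sub by (auto simp: O_plus_def)
qed

text \<open>The hyperboloid equation eliminates \<open>x $ None\<close>. For nonzero
  \<open>l\<close> the displacement thus grows with the distance from the axis.\<close>

lemma cosh_hyp_dist_boost:
  assumes "x \<in> hyperboloid"
  shows "cosh (hyp_dist x (boost k l *v x)) = cosh l + (cosh l - 1) * off_plane k x"
proof -
  have "off_plane k x + (x $ Some k)\<^sup>2 - (x $ None)\<^sup>2 = -1"
    using assms lorentz_form_eq_off_plane[of x k] by (simp add: hyperboloid_def)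
  then have *: "(x $ None)\<^sup>2 = 1 + off_plane k x + (x $ Some k)\<^sup>2" by simp
  have "(\<Sum>i\<in>UNIV. x $ Some i * (boost k l *v x) $ Some i)
      = x $ Some k * (cosh l * x $ Some k + sinh l * x $ None) + off_plane k x"
    by (subst sum.remove[of _ k])
      (auto simp: boost_def plane_block_mult_vec off_plane_def power2_eq_square)
  then have "- lorentz_inner x (boost k l *v x)
      = cosh l * ((x $ None)\<^sup>2 - (x $ Some k)\<^sup>2) - off_plane k x"
    by (simp add: lorentz_inner_def boost_def plane_block_mult_vec power2_eq_square algebra_simps)
  also have "\<dots> = cosh l + (cosh l - 1) * off_plane k x"
    unfolding * by (simp add: algebra_simps)
  finally have eq: "- lorentz_inner x (boost k l *v x) = cosh l + (cosh l - 1) * off_plane k x" .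
  have "1 \<le> cosh l + (cosh l - 1) * off_plane k x"
    using cosh_real_ge_1[of l] off_plane_nonneg[of k x] by (simp add: add_increasing2)
  then show ?thesis
    unfolding hyp_dist_def eq by (rule cosh_arcosh_real)
qed

section \<open>The axis of a boost and its uniqueness\<close>

definition boost_axis :: "'n::finite \<Rightarrow> real \<Rightarrow> real^('n option)" where
  "boost_axis k s = (\<chi> i. if i = None then cosh s else if i = Some k then sinh s else 0)"

lemma boost_boost_axis: "boost k l *v boost_axis k s = boost_axis k (s + l)"
  by (subst Finite_Cartesian_Product.vec_eq_iff, rule allI)
    (case_tac i; simp add: boost_def plane_block_mult_vec boost_axis_def sinh_add cosh_add algebra_simps)

lemma boost_axis_in_hyperboloid: "boost_axis k s \<in> hyperboloid"
  by (simp add: hyperboloid_def lorentz_form_eq_off_plane[of _ k] off_plane_def boost_axis_def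
      cosh_square_eq)

lemma hyp_dist_boost_axis: "hyp_dist (boost_axis k s) (boost_axis k t) = \<bar>s - t\<bar>"
proof -
  have "(\<Sum>i\<in>UNIV. boost_axis k s $ Some i * boost_axis k t $ Some i) = sinh s * sinh t"
    by (simp add: boost_axis_def if_distrib[of "\<lambda>y. y * _"] cong: if_cong)
  then have "- lorentz_inner (boost_axis k s) (boost_axis k t) = cosh \<bar>s - t\<bar>"
    by (simp add: lorentz_inner_def boost_axis_def cosh_diff)
  then show ?thesis unfolding hyp_dist_def by (simp only: arcosh_cosh_real abs_ge_zero)
qed

lemma in_hyperboloid_boost_axis:
  assumes "x \<in> hyperboloid" "off_plane k x = 0"
  shows "x = boost_axis k (arsinh (x $ Some k))"
proof -
  have "(x $ None)\<^sup>2 = (x $ Some k)\<^sup>2 + 1" "0 < x $ None"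
    using assms lorentz_form_eq_off_plane[of x k] by (auto simp: hyperboloid_def)
  then have "x $ None = sqrt ((x $ Some k)\<^sup>2 + 1)" by (metis abs_of_pos real_sqrt_abs)
  then have "x $ None = cosh (arsinh (x $ Some k))" by (simp add: cosh_arsinh_real)
  moreover have "x $ Some i = 0" if "i \<noteq> k" for i
    using assms(2) that by (simp add: off_plane_eq_0_iff)
  ultimately show ?thesis
    by (subst Finite_Cartesian_Product.vec_eq_iff, intro allI, case_tac i) (auto simp: boost_axis_def)
qed

text \<open>\<open>f d\<close> and \<open>f (- d)\<close> are equally far from \<open>f 0\<close>
  and twice as far from each other, so they lie on opposite sides of \<open>f 0\<close> and one of
  them is the target.\<close>

lemma isometry_of_real_line_surj:
  fixes f :: "real \<Rightarrow> real"
  assumes "\<And>s t. \<bar>f s - f t\<bar> = \<bar>s - t\<bar>"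
  shows "surj f"
proof -
  have "\<exists>x. f x = y" for y
  proof -
    define d where "d = y - f 0"
    have "f d = y \<or> f (- d) = y"
      using assms[of d 0] assms[of "- d" 0] assms[of d "- d"] by (simp add: d_def) linarith
    then show ?thesis by blast
  qed
  then show ?thesis by (metis surj_def)
qed

text \<open>Comparing the displacements of a point under \<open>boost k l\<close> and under its square shows that
  the point lies on the axis.\<close>

lemma boost_translates_along_unique:
  assumes l: "0 < l" and tr: "translates_along (boost k l) L m"
  shows "m = l" and "L = range (boost_axis k)"
proof -
  obtain c where m: "0 < m" and c: "geodesic_line c" "range c = L"
    and step: "\<And>t. boost k l *v c t = c (t + m)"
    using tr by (auto simp: translates_along_def)
  have hyp: "c t \<in> hyperboloid" and dist: "hyp_dist (c s) (c t) = \<bar>s - t\<bar>" for s t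
    using c(1) by (auto simp: geodesic_line_def)
  have l1: "1 < cosh l" using l using cosh_real_nonneg_less_iff[of 0 l] by simp
  have 1: "cosh m = cosh l + (cosh l - 1) * off_plane k (c t)" for t
    using cosh_hyp_dist_boost[OF hyp[of t], of k l] dist[of t "t + m"] m by (simp add: step)
  have off: "off_plane k (c t) = 0" for t
  proof -
    define w where "w = off_plane k (c t)"
    \<comment> \<open>The square of the boost moves \<open>c t\<close> by \<open>2 * m\<close>, a
      second equation relating \<open>m\<close> and \<open>w\<close>.\<close>
    have "boost k (2 * l) *v c t = c (t + 2 * m)"
      using boost_boost[of k l l "c t"] step by (simp add: add.assoc)
    then have 2: "cosh (2 * m) = cosh (2 * l) + (cosh (2 * l) - 1) * w"
      using cosh_hyp_dist_boost[OF hyp[of t], of k "2 * l"] dist[of t "t + 2 * m"] m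
      by (simp add: w_def)
    have "2 * (cosh m)\<^sup>2 - 1 = (2 * (cosh l)\<^sup>2 - 1) + (2 * (cosh l)\<^sup>2 - 2) * w"
      using 2 by (simp add: cosh_double_cosh)
    then have "2 * (cosh l + (cosh l - 1) * w)\<^sup>2 - 1
        = (2 * (cosh l)\<^sup>2 - 1) + (2 * (cosh l)\<^sup>2 - 2) * w"
      unfolding 1[of t] w_def .
    \<comment> \<open>With \<open>cosh m\<close> eliminated, only the factor \<open>w\<close> can
      vanish, as \<open>cosh l > 1\<close> and \<open>w\<close> is nonnegative.\<close>
    then have "(cosh l - 1) * (cosh l - 1) * (w * (1 + w)) = 0"
      by (simp add: power2_eq_square algebra_simps)
    then show ?thesis
      using l1 off_plane_nonneg[of k "c t"] by (auto simp: w_def)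
  qed
  have "cosh m = cosh l" using 1[of 0] off by simp
  then show "m = l" using m l by simp
  define s where "s = (\<lambda>t. arsinh (c t $ Some k))"
  have cs: "c t = boost_axis k (s t)" for t
    using in_hyperboloid_boost_axis[OF hyp off] by (simp add: s_def)
  \<comment> \<open>This excludes that \<open>c\<close> covers only part of the axis;
    \<open>s\<close> is an isometry because both curves are parametrised by arc length.\<close>
  have "surj s"
    by (rule isometry_of_real_line_surj) (use dist in \<open>simp add: cs hyp_dist_boost_axis\<close>)
  have "range c = boost_axis k ` range s" using cs by auto
  with \<open>surj s\<close> c(2) show "L = range (boost_axis k)" by simp
qed

lemma translates_along_boost:
  "0 < l \<Longrightarrow> translates_along (boost k l) (range (boost_axis k)) l"
  unfolding translates_along_def geodesic_line_def
  by (auto simp: boost_boost_axis hyp_dist_boost_axis boost_axis_in_hyperboloid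
      intro!: exI[of _ "boost_axis k"])

lemma hyperbolic_isometry_boost: "0 < l \<Longrightarrow> hyperbolic_isometry (boost k l)"
  unfolding hyperbolic_isometry_def
  by (intro conjI boost_in_O_plus ex1I[of _ "range (boost_axis k)"] exI[of _ l])
    (auto intro: translates_along_boost dest: boost_translates_along_unique(2))

lemma translation_length_boost: "0 < l \<Longrightarrow> translation_length (boost k l) = l"
  unfolding translation_length_def
  by (rule the_equality)
    (auto intro!: exI[of _ "range (boost_axis k)"] translates_along_boost
      dest: boost_translates_along_unique(1))

section \<open>The quadratic form\<close>

lemma plane_block_eqI:
  "a = a' \<Longrightarrow> b = b' \<Longrightarrow> c = c' \<Longrightarrow> d = d' \<Longrightarrow> plane_block k a b c d = plane_block k a' b' c' d'"
  by simp

lemma transpose_plane_block: "transpose (plane_block k a b c d) = plane_block k a c b d"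
  by (auto simp: transpose_def plane_block_def Finite_Cartesian_Product.vec_eq_iff)

text \<open>The entries \<open>t / 2\<close> are half the mixed coefficient of
  \<open>x\<^sup>2 + t x y + y\<^sup>2\<close>; they lie in the field but need not be algebraic
  integers.\<close>

definition trace_form :: "'n::finite \<Rightarrow> real \<Rightarrow> real^('n option)^('n option)" where
  "trace_form k t = plane_block k 1 (t / 2) (t / 2) 1"

lemma quad_form_trace_form:
  "quad_form (trace_form k t) x =
     off_plane k x + (x $ Some k)\<^sup>2 + t * x $ Some k * x $ None + (x $ None)\<^sup>2"
proof -
  have "(\<Sum>i\<in>UNIV. x $ Some i * (trace_form k t *v x) $ Some i)
      = x $ Some k * (x $ Some k + t / 2 * x $ None) + off_plane k x"
    by (subst sum.remove[of _ k])
      (auto simp: trace_form_def plane_block_mult_vec off_plane_def power2_eq_square)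
  then show ?thesis
    by (simp add: quad_form_def inner_vec_def sum_UNIV_option)
      (simp add: trace_form_def plane_block_mult_vec power2_eq_square algebra_simps)
qed

text \<open>Completing the square gives the plane part the coefficients 1 and
  \<open>1 - t\<^sup>2 / 4\<close>, the latter positive exactly for
  \<open>\<bar>t\<bar> < 2\<close>.\<close>

lemma positive_definite_trace_form:
  assumes "\<bar>t\<bar> < 2"
  shows "positive_definite_form (trace_form k t)"
  unfolding positive_definite_form_def
proof (intro allI impI)
  fix x :: "real^('a option)"
  assume "x \<noteq> 0"
  define u v where "u = x $ None" and "v = x $ Some k"
  have "t\<^sup>2 < 4" using assms abs_square_less_1[of "t / 2"] by (simp add: power_divide)
  then have s: "0 < 1 - t\<^sup>2 / 4" by simp
  have eq: "quad_form (trace_form k t) x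
      = off_plane k x + ((v + t / 2 * u)\<^sup>2 + (1 - t\<^sup>2 / 4) * u\<^sup>2)"
    unfolding quad_form_trace_form u_def v_def by (simp add: power2_eq_square algebra_simps)
  have nonneg: "0 \<le> off_plane k x" "0 \<le> (v + t / 2 * u)\<^sup>2" "0 \<le> (1 - t\<^sup>2 / 4) * u\<^sup>2"
    using s by (simp_all add: off_plane_nonneg)
  show "0 < quad_form (trace_form k t) x"
  proof (rule ccontr)
    assume "\<not> ?thesis"
    then have 0: "off_plane k x = 0" "(v + t / 2 * u)\<^sup>2 = 0" "(1 - t\<^sup>2 / 4) * u\<^sup>2 = 0"
      using eq nonneg by linarith+
    then have "u = 0" using s by (metis less_irrefl mult_eq_0_iff zero_eq_power2)
    with 0(2) have "v = 0" by simp
    have "x $ i = 0" for i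
      using 0(1) \<open>u = 0\<close> \<open>v = 0\<close> by (cases i) (auto simp: u_def v_def off_plane_eq_0_iff)
    with \<open>x \<noteq> 0\<close> show False by (simp add: Finite_Cartesian_Product.vec_eq_iff)
  qed
qed

text \<open>The coordinates that complete the square for \<open>t = 2 * cosh l\<close>, where the
  second coefficient is \<open>- (sinh l)\<^sup>2\<close>. The last coordinate is merely rescaled by
  \<open>sinh l\<close>.\<close>

definition to_lorentz :: "'n::finite \<Rightarrow> real \<Rightarrow> real^('n option)^('n option)" where
  "to_lorentz k l = plane_block k 1 (cosh l) 0 (sinh l)"

definition from_lorentz :: "'n::finite \<Rightarrow> real \<Rightarrow> real^('n option)^('n option)" where
  "from_lorentz k l = plane_block k 1 (- cosh l / sinh l) 0 (1 / sinh l)"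

lemma to_from_lorentz:
  assumes "0 < l"
  shows "to_lorentz k l ** from_lorentz k l = mat 1" "from_lorentz k l ** to_lorentz k l = mat 1"
proof -
  have "sinh l \<noteq> 0" using assms by simp
  then show "to_lorentz k l ** from_lorentz k l = mat 1" "from_lorentz k l ** to_lorentz k l = mat 1"
    by (simp_all add: to_lorentz_def from_lorentz_def plane_block_mult plane_block_id)
qed

lemma quad_form_to_lorentz:
  "quad_form (trace_form k (2 * cosh l)) x = lorentz_form (to_lorentz k l *v x)"
proof -
  have "(v + cosh l * u)\<^sup>2 - (sinh l * u)\<^sup>2 = v\<^sup>2 + 2 * cosh l * v * u + u\<^sup>2" for u v
  proof -
    have "(v + cosh l * u)\<^sup>2 - (sinh l * u)\<^sup>2
        = v\<^sup>2 + 2 * cosh l * v * u + ((cosh l)\<^sup>2 - (sinh l)\<^sup>2) * u\<^sup>2"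
      by (simp add: power2_eq_square algebra_simps)
    then show ?thesis by (simp add: hyperbolic_pythagoras)
  qed
  from this[of "x $ Some k" "x $ None"] show ?thesis
    unfolding quad_form_trace_form lorentz_form_eq_off_plane[of _ k] to_lorentz_def
    by (simp add: plane_block_mult_vec)
qed

lemma trace_form_eq_to_lorentz:
  "trace_form k (2 * cosh l) = transpose (to_lorentz k l) ** plane_block k 1 0 0 (-1) ** to_lorentz k l"
  unfolding trace_form_def to_lorentz_def transpose_plane_block plane_block_mult
  using hyperbolic_pythagoras[of l]
  by (intro plane_block_eqI) (simp_all add: power2_eq_square)

lemma from_lorentz_diagonalises:
  assumes "0 < l"
  shows "transpose (from_lorentz k l) ** trace_form k (2 * cosh l) ** from_lorentz k l
       = plane_block k 1 0 0 (-1)" (is "transpose ?M ** _ ** _ = ?D")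
proof -
  let ?P = "to_lorentz k l"
  have "transpose ?M ** trace_form k (2 * cosh l) ** ?M
      = transpose (?P ** ?M) ** ?D ** (?P ** ?M)"
    by (simp add: trace_form_eq_to_lorentz matrix_transpose_mul matrix_mul_assoc)
  then show ?thesis
    by (simp add: to_from_lorentz[OF assms] transpose_mat)
qed

lemma has_signature_trace_form:
  assumes "0 < l"
  shows "has_signature (trace_form (k::'n::finite) (2 * cosh l)) CARD('n) 1"
proof -
  define d where "d = (\<lambda>i::'n option. if i = None then -1 else 1 :: real)"
  have "plane_block k 1 0 0 (-1) = (\<chi> i j. if i = j then d i else 0)"
    by (auto simp: plane_block_def Finite_Cartesian_Product.vec_eq_iff d_def)
  moreover have "{i. 0 < d i} = range Some" "{i. d i < 0} = {None}"
    by (auto simp: d_def image_iff split: if_splits option.splits)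
  moreover have "invertible (from_lorentz k l)"
    using to_from_lorentz[OF assms] by (auto simp: invertible_def)
  ultimately show ?thesis
    unfolding has_signature_def using from_lorentz_diagonalises[OF assms, of k]
    by (intro exI[of _ "from_lorentz k l"] exI[of _ d]) (simp add: card_image)
qed

text \<open>Multiplication by a root of \<open>X\<^sup>2 - t X + 1\<close> in the basis given by \<open>1\<close> and that root,
  extended by the identity.\<close>

definition trace_translation :: "'n::finite \<Rightarrow> real \<Rightarrow> real^('n option)^('n option)" where
  "trace_translation k t = plane_block k 0 (-1) 1 t"

lemma trace_translation_preserves:
  "transpose (trace_translation k t) ** trace_form k t ** trace_translation k t = trace_form k t"
  by (simp add: trace_translation_def trace_form_def transpose_plane_block plane_block_mult)

text \<open>The source of the translation length. The entries agree because
  \<open>2 (cosh l)\<^sup>2 - 1 = (cosh l)\<^sup>2 + (sinh l)\<^sup>2\<close>.\<close>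

lemma trace_translation_conj_boost:
  "to_lorentz k l ** trace_translation k (2 * cosh l) = boost k l ** to_lorentz k l"
  unfolding to_lorentz_def trace_translation_def boost_def plane_block_mult
  using hyperbolic_pythagoras[of l]
  by (intro plane_block_eqI) (simp_all add: power2_eq_square algebra_simps)

section \<open>The two components of the negative cone\<close>

lemma convex_future_cone: "convex {x :: real^('n::finite option). lorentz_form x < 0 \<and> 0 < x $ None}"
proof -
  \<comment> \<open>The cone is the strict epigraph of the Euclidean norm of the first coordinates,
    so convexity is the triangle inequality.\<close>
  have iff: "lorentz_form x < 0 \<and> 0 < x $ None \<longleftrightarrow> L2_set (\<lambda>i. x $ Some i) UNIV < x $ None"
    for x :: "real^('n option)"
  proof -
    have "0 \<le> L2_set (\<lambda>i. x $ Some i) UNIV" by simp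
    moreover have "(L2_set (\<lambda>i. x $ Some i) UNIV)\<^sup>2 = (\<Sum>i\<in>UNIV. (x $ Some i)\<^sup>2)"
      by (simp add: L2_set_def sum_nonneg)
    ultimately show ?thesis
      unfolding lorentz_form_def
      by (smt (verit, best) power2_less_imp_less power_strict_mono pos2)
  qed
  show ?thesis
    unfolding iff
  proof (rule convexI)
    fix x y :: "real^('n option)" and u v :: real
    assume x: "x \<in> {x. L2_set (\<lambda>i. x $ Some i) UNIV < x $ None}"
      and y: "y \<in> {x. L2_set (\<lambda>i. x $ Some i) UNIV < x $ None}"
      and uv: "0 \<le> u" "0 \<le> v" "u + v = 1"
    have "L2_set (\<lambda>i. (u *\<^sub>R x + v *\<^sub>R y) $ Some i) UNIV
        \<le> L2_set (\<lambda>i. u * x $ Some i) UNIV + L2_set (\<lambda>i. v * y $ Some i) UNIV"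
      using L2_set_triangle_ineq[of "\<lambda>i. u * x $ Some i" "\<lambda>i. v * y $ Some i" UNIV] by simp
    also have "\<dots> = u * L2_set (\<lambda>i. x $ Some i) UNIV + v * L2_set (\<lambda>i. y $ Some i) UNIV"
      using uv by (simp add: L2_set_right_distrib)
    \<comment> \<open>Bounding the two differences by 0 keeps the inequality strict even if one
      weight is 0.\<close>
    also have "\<dots> < u * x $ None + v * y $ None"
      using convex_bound_lt[of "L2_set (\<lambda>i. x $ Some i) UNIV - x $ None" 0
          "L2_set (\<lambda>i. y $ Some i) UNIV - y $ None" u v] x y uv
      by (simp add: algebra_simps)
    finally show "u *\<^sub>R x + v *\<^sub>R y \<in> {x. L2_set (\<lambda>i. x $ Some i) UNIV < x $ None}"
      by simp
  qed
qed

text \<open>A connected set in the union of two disjoint open sets cannot meet both, so neither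
  piece can be enlarged.\<close>

lemma components_Un_open_disjoint:
  fixes U V :: "'a::topological_space set"
  assumes "open U" "open V" "connected U" "connected V" "U \<noteq> {}" "V \<noteq> {}" "U \<inter> V = {}"
  shows "components (U \<union> V) = {U, V}"
proof -
  have comp: "A \<in> components (A \<union> B)"
    if "open A" "open B" "connected A" "A \<noteq> {}" "A \<inter> B = {}" for A B :: "'a set"
    unfolding in_components_maximal
  proof (intro conjI allI impI)
    fix D assume D: "D \<noteq> {} \<and> A \<subseteq> D \<and> D \<subseteq> A \<union> B \<and> connected D"
    then have "A \<inter> D = {} \<or> B \<inter> D = {}"
      using that by (intro connectedD) auto
    with D that show "D = A" by auto
  qed (use that in auto)
  have "U \<in> components (U \<union> V)" "V \<in> components (U \<union> V)"
    using comp[of U V] comp[of V U] assms by (auto simp: Un_commute Int_commute)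
  moreover have "C = U \<or> C = V" if C: "C \<in> components (U \<union> V)" for C
  proof -
    have "C \<inter> U \<noteq> {} \<or> C \<inter> V \<noteq> {}"
      using in_components_nonempty[OF C] in_components_subset[OF C] by blast
    with C calculation show ?thesis using components_nonoverlap by blast
  qed
  ultimately show ?thesis by blast
qed

definition future_cone :: "real^('n::finite option)^('n option) \<Rightarrow> (real^('n option)) set" where
  "future_cone A = {x. quad_form A x < 0 \<and> 0 < x $ None}"

lemma quad_form_uminus [simp]: "quad_form A (- x) = quad_form A x"
  by (simp add: quad_form_def matrix_vector_mult_def inner_vec_def sum_negf)

text \<open>The upper half is the preimage of a convex cone under \<open>to_lorentz\<close> and the
  lower half its negative. No vector of the cone has last coordinate 0, since there the form is a
  sum of squares.\<close>

lemma components_trace_form_cone: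
  fixes k :: "'n::finite"
  assumes l: "0 < l"
  defines "A \<equiv> trace_form k (2 * cosh l)"
  shows "components {x. quad_form A x < 0} = {future_cone A, uminus ` future_cone A}"
proof -
  have vimage: "future_cone A = (\<lambda>x. to_lorentz k l *v x) -` {x. lorentz_form x < 0 \<and> 0 < x $ None}"
    using l by (auto simp: future_cone_def A_def quad_form_to_lorentz to_lorentz_def
        plane_block_mult_vec zero_less_mult_iff)
  have convex: "convex (future_cone A)"
    unfolding vimage by (intro convex_linear_vimage convex_future_cone) simp
  have open_D: "open (future_cone A)"
    unfolding future_cone_def A_def quad_form_trace_form off_plane_def
    by (intro open_Collect_conj open_Collect_less continuous_intros)
  have mem: "from_lorentz k l *v boost_axis k 0 \<in> future_cone A"
    using boost_axis_in_hyperboloid[of k 0]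
    by (simp add: vimage matrix_vector_mul_assoc to_from_lorentz[OF l] hyperboloid_def)
  have neg: "uminus ` future_cone A = {x. quad_form A x < 0 \<and> x $ None < 0}"
  proof -
    have "x \<in> uminus ` future_cone A" if "quad_form A x < 0" "x $ None < 0" for x
      by (rule image_eqI[of _ _ "- x"]) (use that in \<open>auto simp: future_cone_def\<close>)
    then show ?thesis by (auto simp: future_cone_def)
  qed
  have "x $ None \<noteq> 0" if "quad_form A x < 0" for x
  proof
    assume "x $ None = 0"
    then have "quad_form A x = off_plane k x + (x $ Some k)\<^sup>2"
      by (simp add: A_def quad_form_trace_form)
    then show False
      using that off_plane_nonneg[of k x] zero_le_power2[of "x $ Some k"] by linarith
  qed
  then have "{x. quad_form A x < 0} = future_cone A \<union> uminus ` future_cone A"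
    unfolding neg by (auto simp: future_cone_def neq_iff)
  moreover have "future_cone A \<inter> uminus ` future_cone A = {}"
    unfolding neg by (auto simp: future_cone_def)
  moreover have "components (future_cone A \<union> uminus ` future_cone A) = {future_cone A, uminus ` future_cone A}"
    by (rule components_Un_open_disjoint)
      (use mem convex open_D calculation in
        \<open>auto intro: open_negations convex_connected convex_negations\<close>)
  ultimately show ?thesis by simp
qed

section \<open>The lattice\<close>

lemma quad_form_congruence: "quad_form (transpose T ** A ** T) x = quad_form A (T *v x)"
proof -
  have "quad_form (transpose T ** A ** T) x = x \<bullet> (transpose T *v (A *v (T *v x)))"
    by (simp add: quad_form_def matrix_vector_mul_assoc matrix_mul_assoc)
  also have "\<dots> = quad_form A (T *v x)"
    unfolding quad_form_def dot_lmul_matrix[symmetric, of _ "transpose T"] vector_transpose_matrix ..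
  finally show ?thesis .
qed

lemma group_GL_group: "group (GL_group :: (real^'m^'m::finite) monoid)"
proof (rule groupI)
  fix A :: "real^'m^'m"
  assume "A \<in> carrier GL_group"
  then obtain B where "A ** B = mat 1" "B ** A = mat 1"
    by (auto simp: GL_group_def invertible_def)
  then show "\<exists>B\<in>carrier GL_group. B \<otimes>\<^bsub>GL_group\<^esub> A = \<one>\<^bsub>GL_group\<^esub>"
    by (auto simp: GL_group_def invertible_def)
qed (auto simp: GL_group_def invertible_mult matrix_mul_assoc invertible_def[of "mat 1"]
    intro: exI[of _ "mat 1"])

lemma subgroup_GL_groupI:
  fixes H :: "(real^'m^'m::finite) set"
  assumes one: "mat 1 \<in> H" and mult: "\<And>S T. S \<in> H \<Longrightarrow> T \<in> H \<Longrightarrow> S ** T \<in> H"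
    and inv: "\<And>T. T \<in> H \<Longrightarrow> \<exists>S\<in>H. T ** S = mat 1 \<and> S ** T = mat 1"
  shows "subgroup H GL_group"
proof -
  interpret group "GL_group :: (real^'m^'m) monoid" by (rule group_GL_group)
  have sub: "H \<subseteq> carrier GL_group"
    using inv by (auto simp: GL_group_def invertible_def)
  show ?thesis
  proof (rule subgroupI[OF sub])
    fix T assume T: "T \<in> H"
    then obtain S where S: "S \<in> H" "T ** S = mat 1" "S ** T = mat 1" using inv by blast
    have "inv\<^bsub>GL_group\<^esub> T = S"
      by (rule inv_equality) (use S T sub in \<open>auto simp: GL_group_def\<close>)
    then show "inv\<^bsub>GL_group\<^esub> T \<in> H" using S by simp
  qed (use one mult in \<open>auto simp: GL_group_def\<close>)
qed

text \<open>The only coset of \<open>H\<close> in itself is \<open>H\<close>. This suffices for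
  commensurability because the lattice is conjugate to the whole arithmetic group.\<close>

lemma finite_index_self:
  assumes "group G" "subgroup H G"
  shows "finite_index G H H"
proof -
  interpret H: group "G\<lparr>carrier := H\<rparr>"
    by (rule subgroup.subgroup_is_group[OF assms(2,1)])
  have "H #>\<^bsub>G\<lparr>carrier := H\<rparr>\<^esub> a = H" if "a \<in> H" for a
    using H.coset_join2[OF _ H.subgroup_self] that by simp
  then have "rcosets\<^bsub>G\<lparr>carrier := H\<rparr>\<^esub> H \<subseteq> {H}"
    by (auto simp: RCOSETS_def)
  then show ?thesis
    unfolding finite_index_def by (rule finite_subset) simp
qed

lemma ring_of_integers_closed:
  assumes K: "subfield K real_ring"
  shows "0 \<in> ring_of_integers K" "1 \<in> ring_of_integers K"
    and "x \<in> ring_of_integers K \<Longrightarrow> - x \<in> ring_of_integers K"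
    and "x \<in> ring_of_integers K \<Longrightarrow> y \<in> ring_of_integers K \<Longrightarrow> x + y \<in> ring_of_integers K"
    and "x \<in> ring_of_integers K \<Longrightarrow> y \<in> ring_of_integers K \<Longrightarrow> x * y \<in> ring_of_integers K"
  by (auto simp: ring_of_integers_def subfield_closed[OF K]
      intro: algebraic_int_plus algebraic_int_times)

lemma entries_in_mult:
  assumes "0 \<in> R" "\<And>x y. x \<in> R \<Longrightarrow> y \<in> R \<Longrightarrow> x + y \<in> R" "\<And>x y. x \<in> R \<Longrightarrow> y \<in> R \<Longrightarrow> x * y \<in> R"
    and "entries_in S R" "entries_in T R"
  shows "entries_in (S ** T) R"
proof -
  have "sum f I \<in> R" if "\<And>i. i \<in> I \<Longrightarrow> f i \<in> R" for f :: "'a \<Rightarrow> real" and I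
    using that by (induction I rule: infinite_finite_induct) (auto simp: assms)
  then show ?thesis
    using assms by (auto simp: entries_in_def matrix_matrix_mult_def)
qed

lemma orth_group'_closed:
  fixes A :: "real^'m^'m::finite"
  assumes R: "0 \<in> R" "1 \<in> R" "\<And>x y. x \<in> R \<Longrightarrow> y \<in> R \<Longrightarrow> x + y \<in> R"
    "\<And>x y. x \<in> R \<Longrightarrow> y \<in> R \<Longrightarrow> x * y \<in> R"
  shows orth_group'_one: "mat 1 \<in> orth_group' A R"
    and orth_group'_mult: "\<lbrakk>S \<in> orth_group' A R; T \<in> orth_group' A R\<rbrakk> \<Longrightarrow> S ** T \<in> orth_group' A R"
    and orth_group'_inverse:
      "T \<in> orth_group' A R \<Longrightarrow> \<exists>S \<in> orth_group' A R. T ** S = mat 1 \<and> S ** T = mat 1"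
proof -
  have "entries_in (mat 1 :: real^'m^'m) R"
    using R by (simp add: entries_in_def Finite_Cartesian_Product.mat_def)
  then show "mat 1 \<in> orth_group' A R"
    by (auto simp: orth_group'_def GL_over_def transpose_mat intro!: exI[of _ "mat 1"])
next
  assume S: "S \<in> orth_group' A R" and T: "T \<in> orth_group' A R"
  obtain S' where S': "entries_in S' R" "S ** S' = mat 1" "S' ** S = mat 1"
    using S by (auto simp: orth_group'_def GL_over_def)
  obtain T' where T': "entries_in T' R" "T ** T' = mat 1" "T' ** T = mat 1"
    using T by (auto simp: orth_group'_def GL_over_def)
  have "(S ** T) ** (T' ** S') = S ** (T ** T') ** S'" "(T' ** S') ** (S ** T) = T' ** (S' ** S) ** T"
    by (simp_all add: matrix_mul_assoc)
  then have inv: "(S ** T) ** (T' ** S') = mat 1" "(T' ** S') ** (S ** T) = mat 1"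
    using S' T' by simp_all
  have entries: "entries_in (S ** T) R" "entries_in (T' ** S') R"
    using S T S' T' by (auto intro!: entries_in_mult R simp: orth_group'_def GL_over_def)
  have "transpose (S ** T) ** A ** (S ** T) = transpose T ** (transpose S ** A ** S) ** T"
    by (simp add: matrix_transpose_mul matrix_mul_assoc)
  also have "\<dots> = A" using S T by (simp add: orth_group'_def)
  finally have pres: "transpose (S ** T) ** A ** (S ** T) = A" .
  have "(\<lambda>x. (S ** T) *v x) ` C = C" if C: "C \<in> components {x. quad_form A x < 0}" for C
  proof -
    have "(\<lambda>x. (S ** T) *v x) ` C = (\<lambda>x. S *v x) ` (\<lambda>x. T *v x) ` C"
      by (simp add: image_image matrix_vector_mul_assoc)
    then show ?thesis using S T C by (simp add: orth_group'_def)
  qed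
  then show "S ** T \<in> orth_group' A R"
    using inv entries pres by (auto simp: orth_group'_def GL_over_def)
next
  assume T: "T \<in> orth_group' A R"
  then obtain S where S: "entries_in S R" "T ** S = mat 1" "S ** T = mat 1"
    by (auto simp: orth_group'_def GL_over_def)
  have "transpose S ** A ** S = transpose S ** (transpose T ** A ** T) ** S"
    using T by (simp add: orth_group'_def)
  also have "\<dots> = transpose (T ** S) ** A ** (T ** S)"
    by (simp add: matrix_transpose_mul matrix_mul_assoc)
  finally have pres: "transpose S ** A ** S = A" using S by (simp add: transpose_mat)
  \<comment> \<open>The condition on components is an equality of sets, so it passes to the
    inverse.\<close>
  have "(\<lambda>x. S *v x) ` C = C" if C: "C \<in> components {x. quad_form A x < 0}" for C
  proof -
    have "(\<lambda>x. T *v x) ` C = C" using T C by (simp add: orth_group'_def)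
    then have "(\<lambda>x. S *v x) ` C = (\<lambda>x. S *v x) ` (\<lambda>x. T *v x) ` C" by simp
    also have "\<dots> = C" by (simp add: image_image matrix_vector_mul_assoc S)
    finally show ?thesis .
  qed
  then have "S \<in> orth_group' A R"
    using T S pres by (auto simp: orth_group'_def GL_over_def)
  then show "\<exists>S \<in> orth_group' A R. T ** S = mat 1 \<and> S ** T = mat 1" using S by blast
qed

section \<open>Conjugation into the Lorentz group\<close>

context
  fixes k :: "'n::finite" and l :: real
  assumes l: "0 < l"
begin

lemma from_to_lorentz_vec [simp]:
  "to_lorentz k l *v (from_lorentz k l *v x) = x" "from_lorentz k l *v (to_lorentz k l *v x) = x"
  by (simp_all add: matrix_vector_mul_assoc to_from_lorentz[OF l])

lemma quad_form_from_lorentz: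
  "quad_form (trace_form k (2 * cosh l)) (from_lorentz k l *v x) = lorentz_form x"
  by (simp add: quad_form_to_lorentz)

lemma from_lorentz_None_pos: "0 < (from_lorentz k l *v x) $ None \<longleftrightarrow> 0 < x $ None"
  using l by (simp add: from_lorentz_def plane_block_mult_vec zero_less_divide_iff)

lemma to_lorentz_None_pos: "0 < (to_lorentz k l *v x) $ None \<longleftrightarrow> 0 < x $ None"
  using l by (simp add: to_lorentz_def plane_block_mult_vec zero_less_mult_iff)

text \<open>Invariance of the form alone would allow the two sheets to be exchanged; keeping each
  component of the negative cone excludes this.\<close>

lemma conj_orth_group'_in_O_plus:
  assumes T: "T \<in> orth_group' (trace_form k (2 * cosh l)) R"
  shows "to_lorentz k l ** T ** from_lorentz k l \<in> O_plus"
proof -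
  define A where "A = trace_form k (2 * cosh l)"
  let ?P = "to_lorentz k l" and ?M = "from_lorentz k l"
  have pres: "quad_form A (T *v x) = quad_form A x" for x
    using T quad_form_congruence[of T A x] by (simp add: orth_group'_def A_def)
  have cone: "(\<lambda>x. T *v x) ` future_cone A = future_cone A"
    using T components_trace_form_cone[OF l, of k] by (simp add: orth_group'_def A_def)
  have conj_apply: "(?P ** T ** ?M) *v x = ?P *v (T *v (?M *v x))" for x
    by (simp add: matrix_vector_mul_assoc matrix_mul_assoc)
  have form: "lorentz_form (?P *v (T *v (?M *v x))) = lorentz_form x" for x
    using pres[of "?M *v x"] by (simp add: A_def quad_form_to_lorentz)
  have "?P *v (T *v (?M *v x)) \<in> hyperboloid" if x: "x \<in> hyperboloid" for x
  proof -
    have "?M *v x \<in> future_cone A"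
      using x by (simp add: future_cone_def A_def hyperboloid_def quad_form_from_lorentz
          from_lorentz_None_pos)
    then have "T *v (?M *v x) \<in> future_cone A" using cone by blast
    then show ?thesis
      using x form[of x] by (simp add: hyperboloid_def future_cone_def to_lorentz_None_pos)
  qed
  moreover have "\<exists>x\<in>hyperboloid. y = ?P *v (T *v (?M *v x))" if y: "y \<in> hyperboloid" for y
  proof -
    have "?M *v y \<in> future_cone A"
      using y by (simp add: future_cone_def A_def hyperboloid_def quad_form_from_lorentz
          from_lorentz_None_pos)
    then obtain z where z: "z \<in> future_cone A" "?M *v y = T *v z" using cone by blast
    have "?P *v (T *v (?M *v (?P *v z))) = y"
      by (simp add: z(2)[symmetric])
    moreover from this have "?P *v z \<in> hyperboloid"
      using y z(1) form[of "?P *v z"] by (simp add: hyperboloid_def future_cone_def to_lorentz_None_pos)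
    ultimately show ?thesis by (intro bexI[of _ "?P *v z"]) simp_all
  qed
  ultimately show ?thesis
    using form by (auto simp: O_plus_def conj_apply image_iff)
qed

lemma trace_translation_eq:
  "trace_translation k (2 * cosh l) *v x = from_lorentz k l *v (boost k l *v (to_lorentz k l *v x))"
proof -
  have "to_lorentz k l *v (trace_translation k (2 * cosh l) *v x)
      = boost k l *v (to_lorentz k l *v x)"
    by (simp add: matrix_vector_mul_assoc trace_translation_conj_boost)
  then show ?thesis by (metis from_to_lorentz_vec(2))
qed

text \<open>The map is conjugate to a boost, which keeps the cone; the boost by \<open>- l\<close>
  supplies preimages.\<close>

lemma trace_translation_future_cone:
  defines "A \<equiv> trace_form k (2 * cosh l)"
  shows "(\<lambda>x. trace_translation k (2 * cosh l) *v x) ` future_cone A = future_cone A"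
proof -
  let ?T = "\<lambda>m x. from_lorentz k l *v (boost k m *v (to_lorentz k l *v x))"
  have sub: "?T m x \<in> future_cone A" if "x \<in> future_cone A" for m x
    using that boost_None_pos[of "to_lorentz k l *v x" k m]
    by (simp add: future_cone_def A_def quad_form_to_lorentz from_lorentz_None_pos to_lorentz_None_pos)
  have "?T l (?T (- l) x) = x" for x
    by (simp add: boost_boost boost_0)
  then have "x \<in> ?T l ` future_cone A" if "x \<in> future_cone A" for x
    using sub[OF that, of "- l"] by (intro image_eqI[of _ _ "?T (- l) x"]) auto
  then show ?thesis
    using sub[of _ l] by (auto simp: trace_translation_eq)
qed

lemma trace_translation_in_orth_group':
  assumes R: "0 \<in> R" "1 \<in> R" "-1 \<in> R" "2 * cosh l \<in> R"
  shows "trace_translation k (2 * cosh l) \<in> orth_group' (trace_form k (2 * cosh l)) R"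
proof -
  define A where "A = trace_form k (2 * cosh l)"
  define T where "T = trace_translation k (2 * cosh l)"
  \<comment> \<open>The inverse of a block of determinant 1 is its adjugate, so its entries stay in
    \<open>R\<close>.\<close>
  define S where "S = plane_block k (2 * cosh l) 1 (-1) 0"
  have inv: "T ** S = mat 1" "S ** T = mat 1"
    by (simp_all add: T_def S_def trace_translation_def plane_block_mult plane_block_id)
  have entries: "entries_in T R" "entries_in S R"
    using R by (auto simp: entries_in_def T_def S_def trace_translation_def plane_block_def)
  have cone: "(\<lambda>x. T *v x) ` future_cone A = future_cone A"
    unfolding T_def A_def by (rule trace_translation_future_cone)
  have "(\<lambda>x. T *v x) ` uminus ` future_cone A = uminus ` (\<lambda>x. T *v x) ` future_cone A"
    by (simp add: image_image linear_neg[OF matrix_vector_mul_linear])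
  with cone have "(\<lambda>x. T *v x) ` C = C" if "C \<in> components {x. quad_form A x < 0}" for C
    using that components_trace_form_cone[OF l, of k] by (auto simp: A_def)
  then show ?thesis
    using inv entries trace_translation_preserves[of k "2 * cosh l"]
    by (auto simp: orth_group'_def GL_over_def A_def T_def)
qed

end

lemma admissible_trace_form:
  fixes k :: "'n::finite"
  assumes salem: "salem_number lam" and l: "0 < l" "2 * cosh l = lam + inverse lam"
  shows "admissible_form (rat_adjoin (lam + inverse lam)) (trace_form k (lam + inverse lam))"
proof -
  define t where "t = lam + inverse lam"
  note K = subfield_rat_adjoin[of t]
  \<comment> \<open>Halving becomes multiplication by a rational element of the field, to which the
    rules for subfields and embeddings apply.\<close>
  have half: "t / 2 = of_rat (1 / 2) * t" by (simp add: of_rat_divide)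
  have entries: "entries_in (trace_form k t) (rat_adjoin t)"
    using subfield_mult[OF K subfield_of_rat[OF K] rat_adjoin_self, of "1 / 2"]
    by (auto simp: entries_in_def trace_form_def plane_block_def half subfield_closed[OF K])
  have posdef: "positive_definite_form (map_matrix \<sigma> (trace_form k t))"
    if \<sigma>: "\<sigma> \<in> field_embeddings (rat_adjoin t)" and x: "x \<in> rat_adjoin t" "\<sigma> x \<noteq> x"
    for \<sigma> :: "real \<Rightarrow> real" and x
  proof -
    have "\<sigma> t \<noteq> t" using field_embedding_rat_adjoin_id[OF \<sigma>] x by blast
    then have "\<bar>\<sigma> t\<bar> < 2"
      using salem_number_real_embedded_trace[OF salem] \<sigma> by (simp add: t_def)
    moreover have "\<sigma> (t / 2) = \<sigma> t / 2"
      unfolding half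
      using field_embedding_mult[OF K \<sigma> subfield_of_rat[OF K] rat_adjoin_self, of "1 / 2"]
        field_embedding_of_rat[OF K \<sigma>, of "1 / 2"]
      by (simp add: of_rat_divide)
    then have "map_matrix \<sigma> (trace_form k t) = trace_form k (\<sigma> t)"
      by (auto simp: Finite_Cartesian_Product.vec_eq_iff trace_form_def plane_block_def
          field_embedding_hom[OF K \<sigma>])
    ultimately show ?thesis by (simp add: positive_definite_trace_form)
  qed
  show ?thesis
    unfolding admissible_form_def t_def[symmetric]
    using entries posdef has_signature_trace_form[OF l(1), of k] l(2)
    by (auto simp: t_def trace_form_def transpose_plane_block)
qed

theorem corollary1p2:
  fixes lam :: real
  assumes "salem_number lam"
    and "CARD('n::finite) \<ge> 2"
  shows "\<exists>\<Gamma> :: (real^('n option)^('n option)) set.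
           simplest_type_lattice (rat_adjoin (lam + inverse lam)) \<Gamma> \<and>
           (\<exists>\<gamma> \<in> \<Gamma>. hyperbolic_isometry \<gamma> \<and> lam = exp (translation_length \<gamma>))"
proof -
  \<comment> \<open>Any coordinate serves as the spatial direction of the boost.\<close>
  fix k :: 'n
  define l where "l = ln lam"
  define t where "t = lam + inverse lam"
  define R where "R = ring_of_integers (rat_adjoin t)"
  define A where "A = trace_form k t"
  define M where "M = from_lorentz k l"
  define P where "P = to_lorentz k l"
  have "1 < lam" using assms(1) by (simp add: salem_number_def)
  then have l: "0 < l" and exp_l: "exp l = lam" by (simp_all add: l_def)
  \<comment> \<open>This turns the results stated for \<open>2 * cosh l\<close> into results on the
    trace.\<close>
  have t: "2 * cosh l = t" by (simp add: cosh_def exp_minus exp_l t_def)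
  note R_closed = ring_of_integers_closed[OF subfield_rat_adjoin[of t], folded R_def]
  have PM: "P ** M = mat 1" "M ** P = mat 1"
    using to_from_lorentz[OF l] by (simp_all add: P_def M_def)
  have "invertible M" using PM by (auto simp: invertible_def)
  \<comment> \<open>\<open>matrix_inv\<close> is a Hilbert choice and has to be identified with
    \<open>P\<close>.\<close>
  then have "matrix_inv M ** M = mat 1"
    unfolding matrix_inv_def invertible_def by (rule someI2_ex) simp
  then have "matrix_inv M ** (M ** P) = P" by (simp add: matrix_mul_assoc)
  then have inv_M: "matrix_inv M = P" by (simp add: PM)
  \<comment> \<open>Taking the full conjugate reduces commensurability to an equality of
    groups.\<close>
  define \<Gamma> where "\<Gamma> = (\<lambda>T. P ** T ** M) ` orth_group' A R"
  have conj_mult: "P ** S ** M ** (P ** T ** M) = P ** (S ** T) ** M" for S T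
  proof -
    have "P ** S ** M ** (P ** T ** M) = P ** S ** (M ** P) ** T ** M"
      by (simp add: matrix_mul_assoc)
    then show ?thesis by (simp add: PM matrix_mul_assoc)
  qed
  have "subgroup \<Gamma> GL_group"
  proof (rule subgroup_GL_groupI)
    show "mat 1 \<in> \<Gamma>"
      using orth_group'_one[OF R_closed(1,2,4,5), of A] PM
      by (auto simp: \<Gamma>_def intro!: image_eqI[of _ _ "mat 1"])
    show "S ** T \<in> \<Gamma>" if "S \<in> \<Gamma>" "T \<in> \<Gamma>" for S T
      using that orth_group'_mult[OF R_closed(1,2,4,5), of _ A] by (auto simp: \<Gamma>_def conj_mult)
    show "\<exists>S\<in>\<Gamma>. T ** S = mat 1 \<and> S ** T = mat 1" if T: "T \<in> \<Gamma>" for T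
    proof -
      obtain U where U: "U \<in> orth_group' A R" "T = P ** U ** M" using T by (auto simp: \<Gamma>_def)
      then obtain V where "V \<in> orth_group' A R" "U ** V = mat 1" "V ** U = mat 1"
        using orth_group'_inverse[OF R_closed(1,2,4,5)] by blast
      then show ?thesis
        using PM U by (intro bexI[of _ "P ** V ** M"]) (simp_all add: \<Gamma>_def conj_mult)
    qed
  qed
  moreover have "\<Gamma> \<subseteq> O_plus"
    using conj_orth_group'_in_O_plus[OF l, of _ k R] by (auto simp: \<Gamma>_def A_def P_def M_def t)
  moreover have "(\<lambda>T. M ** T ** matrix_inv M) ` \<Gamma> = orth_group' A R"
  proof -
    have "M ** (P ** T ** M) ** P = (M ** P) ** T ** (M ** P)" for T
      by (simp add: matrix_mul_assoc)
    then show ?thesis by (simp add: \<Gamma>_def inv_M image_image PM)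
  qed
  moreover have "commensurable GL_group (orth_group' A R) (orth_group' A R)"
  proof -
    have "subgroup (orth_group' A R) GL_group"
      by (intro subgroup_GL_groupI orth_group'_one orth_group'_mult orth_group'_inverse R_closed)
    then show ?thesis
      by (simp add: commensurable_def finite_index_self group_GL_group)
  qed
  moreover have "admissible_form (rat_adjoin t) A"
    using admissible_trace_form[OF assms(1) l] t by (simp add: A_def t_def)
  moreover have "quad_form A (M *v x) = lorentz_form x" for x
    using quad_form_from_lorentz[OF l, of k x] by (simp add: A_def M_def t)
  ultimately have lattice: "simplest_type_lattice (rat_adjoin t) \<Gamma>"
    unfolding simplest_type_lattice_def R_def[symmetric]
    using salem_number_totally_real[OF assms(1), folded t_def] \<open>invertible M\<close>
    by - (intro conjI; (rule exI[of _ A], rule exI[of _ M])?; simp)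
  have "t \<in> R"
    using salem_number_algebraic_int_trace[OF assms(1)]
    by (simp add: R_def ring_of_integers_def t_def rat_adjoin_self)
  then have "trace_translation k t \<in> orth_group' A R"
    using trace_translation_in_orth_group'[OF l, of R k] R_closed(1,2,3) by (simp add: A_def t)
  moreover have "P ** trace_translation k t ** M = boost k l"
    using trace_translation_conj_boost[of k l]
    by (simp add: t P_def M_def matrix_mul_assoc[symmetric] to_from_lorentz[OF l])
  ultimately have "boost k l \<in> \<Gamma>"
    unfolding \<Gamma>_def by (metis imageI)
  then show ?thesis
    using lattice hyperbolic_isometry_boost[OF l, of k] translation_length_boost[OF l, of k] exp_l
    unfolding t_def by (intro exI[of _ \<Gamma>] conjI bexI[of _ "boost k l"]) auto
qed

end
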